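(* Let $H$ and $K$ be nontrivial groups. Then $|\mathcal{C}(H\times K)|$ is not simply connected (i.e. $\pi_1(\mathcal{C}(H\times K))\neq 1$) if and only if both $H$ and $K$ are cyclic groups of prime-power order.
   Context: For a group $G$, the coset poset $\mathcal{C}(G)$ is the set of left cosets of all proper subgroups of $G$ (including the trivial subgroup), ordered by inclusion, and $|\mathcal{C}(G)|$ is the geometric realization of its order complex (chains). *)

theory Defs
  imports "HOL-Analysis.Analysis" "HOL-Algebra.Algebra"
begin

definition coset_poset :: "('a, 'm) monoid_scheme \<Rightarrow> 'a set set" where
  "coset_poset G = {x <#\<^bsub>G\<^esub> S | x S. x \<in> carrier G \<and> subgroup S G \<and> S \<noteq> carrier G}"

definition poset_chain :: "'v set \<Rightarrow> ('v \<Rightarrow> 'v \<Rightarrow> bool) \<Rightarrow> 'v set \<Rightarrow> bool" where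
  "poset_chain V rel \<sigma> \<longleftrightarrow> finite \<sigma> \<and> \<sigma> \<noteq> {} \<and> \<sigma> \<subseteq> V \<and>
     (\<forall>x\<in>\<sigma>. \<forall>y\<in>\<sigma>. rel x y \<or> rel y x)"

definition geom_simplex :: "'v set \<Rightarrow> ('v \<Rightarrow> real) set" where
  "geom_simplex \<sigma> = {f. (\<forall>v. 0 \<le> f v) \<and> (\<forall>v. v \<notin> \<sigma> \<longrightarrow> f v = 0) \<and> sum f \<sigma> = 1}"

definition realization_carrier :: "'v set \<Rightarrow> ('v \<Rightarrow> 'v \<Rightarrow> bool) \<Rightarrow> ('v \<Rightarrow> real) set" where
  "realization_carrier V rel = \<Union>{geom_simplex \<sigma> | \<sigma>. poset_chain V rel \<sigma>}"

definition realization_open :: "'v set \<Rightarrow> ('v \<Rightarrow> 'v \<Rightarrow> bool) \<Rightarrow> ('v \<Rightarrow> real) set \<Rightarrow> bool" where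
  "realization_open V rel U \<longleftrightarrow> U \<subseteq> realization_carrier V rel \<and>
     (\<forall>\<sigma>. poset_chain V rel \<sigma> \<longrightarrow>
        openin (subtopology (powertop_real UNIV) (geom_simplex \<sigma>)) (U \<inter> geom_simplex \<sigma>))"

text \<open>Weak (coherent) topology: a set is open iff it meets every closed simplex in an
  open subset of that simplex (with its Euclidean topology).\<close>

definition order_complex_realization :: "'v set \<Rightarrow> ('v \<Rightarrow> 'v \<Rightarrow> bool) \<Rightarrow> ('v \<Rightarrow> real) topology" where
  "order_complex_realization V rel = topology (realization_open V rel)"

lemma istopology_realization_open: "istopology (realization_open V rel)"
  unfolding istopology_def
proof (intro conjI allI impI)
  fix S T assume S: "realization_open V rel S" and T: "realization_open V rel T"
  show "realization_open V rel (S \<inter> T)"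
    unfolding realization_open_def
  proof (intro conjI allI impI)
    show "S \<inter> T \<subseteq> realization_carrier V rel" using S by (auto simp: realization_open_def)
    fix \<sigma> assume c: "poset_chain V rel \<sigma>"
    have "S \<inter> T \<inter> geom_simplex \<sigma> = (S \<inter> geom_simplex \<sigma>) \<inter> (T \<inter> geom_simplex \<sigma>)" by blast
    then show "openin (subtopology (powertop_real UNIV) (geom_simplex \<sigma>)) (S \<inter> T \<inter> geom_simplex \<sigma>)"
      using S T c by (auto simp: realization_open_def intro: openin_Int)
  qed
next
  fix K assume K: "\<forall>S\<in>K. realization_open V rel S"
  show "realization_open V rel (\<Union>K)"
    unfolding realization_open_def
  proof (intro conjI allI impI)
    show "\<Union>K \<subseteq> realization_carrier V rel" using K by (auto simp: realization_open_def)
    fix \<sigma> assume c: "poset_chain V rel \<sigma>"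
    have "\<Union>K \<inter> geom_simplex \<sigma> = \<Union>((\<lambda>S. S \<inter> geom_simplex \<sigma>) ` K)" by blast
    moreover have "openin (subtopology (powertop_real UNIV) (geom_simplex \<sigma>)) (\<Union>((\<lambda>S. S \<inter> geom_simplex \<sigma>) ` K))"
      using K c by (intro openin_Union) (auto simp: realization_open_def)
    ultimately show "openin (subtopology (powertop_real UNIV) (geom_simplex \<sigma>)) (\<Union>K \<inter> geom_simplex \<sigma>)"
      by simp
  qed
qed

definition simply_connected_space :: "'t topology \<Rightarrow> bool" where
  "simply_connected_space T \<longleftrightarrow> path_connected_space T \<and>
     (\<forall>g. pathin T g \<and> g (1::real) = g 0 \<longrightarrow>
        homotopic_with (\<lambda>h. h (0::real) = g 0 \<and> h (1::real) = g 0)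
          (subtopology euclideanreal {0..1}) T g (\<lambda>t. g 0))"

definition cyclic_prime_power_group :: "('a, 'm) monoid_scheme \<Rightarrow> bool" where
  "cyclic_prime_power_group G \<longleftrightarrow> cyclic_group G \<and> finite (carrier G) \<and>
     (\<exists>p k. Factorial_Ring.prime (p::nat) \<and> card (carrier G) = p ^ k)"

end

(*
  The realization of an order complex is treated as a simplicial complex with the weak topology.
  A compact set lies in a finite subcomplex, where that topology is the product topology, and a
  path inside the open star of a vertex is homotopic to one through the vertex; so the complex is
  simply connected once every vertex v has an edge path c v to a base vertex such that u # c v is
  homotopic to c u for adjacent u and v.

  If H is not cyclic of prime power order, then every g in G = H x K is a product of two powers of
  g whose components in H do not generate H.  An edge path x, C, y through a coset C thus splits
  into two pieces that lie in cosets A x K with A a proper coset in H, and such pieces can be pushed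
  into the single proper coset H x 1.  Only the projection of G onto H x 1, an idempotent
  endomorphism, enters the argument, so K is treated in the same way.

  If H and K are cyclic of orders p^m and q^n with generators a and b, the closed edge path
  1, H x 1, (a,1), a x K, (a,b), H x b, (1,b), 1 x K, 1 crosses once an "edge" of the image of the
  coset poset in the coset poset of Z/p x Z/q.  Collapsing everything but this edge gives a map to
  the circle on which the path has winding number 1.
*)
theory Submission
  imports Defs "HOL-Complex_Analysis.Winding_Numbers"
begin

section \<open>The weak topology on the realization\<close>

locale vertex_relation =
  fixes V :: "'v set" and rel :: "'v \<Rightarrow> 'v \<Rightarrow> bool"
begin

abbreviation realization where "realization \<equiv> order_complex_realization V rel"

text \<open>The full subcomplex spanned by \<open>F\<close>. For finite \<open>F\<close> it is a
  finite union of simplexes, each closed in the product topology, so on it the weak topology and the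
  product topology agree.\<close>

definition subcomplex :: "'v set \<Rightarrow> ('v \<Rightarrow> real) set" where
  "subcomplex F = {f \<in> realization_carrier V rel. \<forall>v. v \<notin> F \<longrightarrow> f v = 0}"

lemma openin_realization: "openin realization U \<longleftrightarrow> realization_open V rel U"
  by (simp add: order_complex_realization_def istopology_realization_open topology_inverse')

text \<open>On a function type \<open>euclidean\<close> is the product topology, so traces on
  simplexes can be handled with \<open>closed\<close> and \<open>continuous_on\<close>.\<close>

lemma realization_open_iff:
  "realization_open V rel U \<longleftrightarrow> U \<subseteq> realization_carrier V rel \<and>
     (\<forall>\<sigma>. poset_chain V rel \<sigma> \<longrightarrow> openin (top_of_set (geom_simplex \<sigma>)) (U \<inter> geom_simplex \<sigma>))"
  by (simp add: realization_open_def euclidean_product_topology)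

lemma simplex_subset_carrier: "poset_chain V rel \<sigma> \<Longrightarrow> geom_simplex \<sigma> \<subseteq> realization_carrier V rel"
  by (auto simp: realization_carrier_def)

lemma topspace_realization [simp]: "topspace realization = realization_carrier V rel"
proof -
  have "realization_open V rel (realization_carrier V rel)"
    unfolding realization_open_iff using simplex_subset_carrier by (auto simp: Int_absorb1)
  then show ?thesis
    unfolding topspace_def openin_realization by (auto simp: realization_open_iff)
qed

text \<open>Dropping the zero coordinates from a chain that carries \<open>f\<close> keeps the sum
  equal to 1, so a nonempty subset of a chain remains. The support thus spans the smallest simplex
  containing \<open>f\<close>.\<close>

lemma support_chain:
  assumes "f \<in> realization_carrier V rel"
  shows "poset_chain V rel {v. f v \<noteq> 0}" "f \<in> geom_simplex {v. f v \<noteq> 0}"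
proof -
  obtain \<sigma> where \<sigma>: "poset_chain V rel \<sigma>" "f \<in> geom_simplex \<sigma>"
    using assms by (auto simp: realization_carrier_def)
  have sub: "{v. f v \<noteq> 0} \<subseteq> \<sigma>" using \<sigma> by (auto simp: geom_simplex_def)
  have sum: "sum f {v. f v \<noteq> 0} = sum f \<sigma>"
    using \<sigma> sub by (intro sum.mono_neutral_left) (auto simp: poset_chain_def)
  then have "{v. f v \<noteq> 0} \<noteq> {}" using \<sigma> by (intro notI) (simp add: geom_simplex_def)
  then show "poset_chain V rel {v. f v \<noteq> 0}"
    using \<sigma> sub by (auto simp: poset_chain_def intro: finite_subset)
  show "f \<in> geom_simplex {v. f v \<noteq> 0}"
    using \<sigma> sum by (auto simp: geom_simplex_def)
qed

lemma carrier_finite_support: "f \<in> realization_carrier V rel \<Longrightarrow> finite {v. f v \<noteq> 0}"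
  using support_chain(1)[of f] by (auto simp: poset_chain_def)

section \<open>Finite subcomplexes, continuity and compactness\<close>

lemma subcomplex_mono: "F \<subseteq> F' \<Longrightarrow> subcomplex F \<subseteq> subcomplex F'"
  by (auto simp: subcomplex_def)

lemma simplex_subset_subcomplex:
  "poset_chain V rel \<sigma> \<Longrightarrow> \<sigma> \<subseteq> F \<Longrightarrow> geom_simplex \<sigma> \<subseteq> subcomplex F"
  using simplex_subset_carrier by (auto simp: subcomplex_def geom_simplex_def)

lemma closed_geom_simplex: "finite \<sigma> \<Longrightarrow> closed (geom_simplex \<sigma> :: ('v \<Rightarrow> real) set)"
proof -
  have *: "continuous_on UNIV (\<lambda>f::'v\<Rightarrow>real. f v)" for v
    by (rule continuous_on_product_coordinates)
  have eq: "geom_simplex \<sigma> = (\<Inter>v. {f::'v\<Rightarrow>real. 0 \<le> f v}) \<inter> (\<Inter>v\<in>-\<sigma>. {f. f v = 0}) \<inter> {f. sum f \<sigma> = 1}"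
    by (auto simp: geom_simplex_def)
  have 1: "closed {f::'v\<Rightarrow>real. 0 \<le> f v}" for v
    by (intro closed_Collect_le continuous_intros *)
  have 2: "closed {f::'v\<Rightarrow>real. f v = 0}" for v
    by (intro closed_Collect_eq continuous_intros *)
  have 3: "closed {f::'v\<Rightarrow>real. sum f \<sigma> = 1}"
    by (intro closed_Collect_eq continuous_intros *)
  show ?thesis unfolding eq by (intro closed_Int closed_INT ballI 1 2 3)
qed

text \<open>Inside \<open>subcomplex F\<close> the complement of an open \<open>U\<close> is the
  trace of \<open>D\<close>, a union of finitely many closed sets, one for each chain in
  \<open>F\<close>. The preimage of \<open>U\<close> is therefore the preimage of the open set
  \<open>- D\<close>.\<close>

lemma continuous_map_into_realization:
  assumes cont: "continuous_map Z euclidean \<phi>" and F: "finite F"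
    and im: "\<phi> ` topspace Z \<subseteq> subcomplex F"
  shows "continuous_map Z realization \<phi>"
  unfolding continuous_map
proof (intro conjI allI impI)
  show "\<phi> ` topspace Z \<subseteq> topspace realization" using im by (auto simp: subcomplex_def)
  fix U assume "openin realization U"
  then have U: "U \<subseteq> realization_carrier V rel"
    "\<And>\<sigma>. poset_chain V rel \<sigma> \<Longrightarrow> openin (top_of_set (geom_simplex \<sigma>)) (U \<inter> geom_simplex \<sigma>)"
    by (auto simp: openin_realization realization_open_iff)
  define D where "D = (\<Union>\<sigma>\<in>{\<sigma>. poset_chain V rel \<sigma> \<and> \<sigma> \<subseteq> F}. geom_simplex \<sigma> - U)"
  have "closed (geom_simplex \<sigma> - U)" if \<sigma>: "poset_chain V rel \<sigma>" for \<sigma>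
  proof -
    have "geom_simplex \<sigma> - (geom_simplex \<sigma> - U) = U \<inter> geom_simplex \<sigma>" by auto
    then have "closedin (top_of_set (geom_simplex \<sigma>)) (geom_simplex \<sigma> - U)"
      using U(2)[OF \<sigma>] by (simp add: closedin_def)
    moreover have "finite \<sigma>" using \<sigma> by (simp add: poset_chain_def)
    ultimately show ?thesis by (rule closedin_closed_trans[OF _ closed_geom_simplex])
  qed
  moreover have "finite {\<sigma>. poset_chain V rel \<sigma> \<and> \<sigma> \<subseteq> F}"
    by (rule finite_subset[of _ "Pow F"]) (use F in auto)
  ultimately have "closed D" unfolding D_def by (intro closed_UN) auto
  have "{x \<in> topspace Z. \<phi> x \<in> U} = {x \<in> topspace Z. \<phi> x \<in> - D}"
  proof -
    have "f \<in> U \<longleftrightarrow> f \<notin> D" if "f \<in> subcomplex F" for f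
    proof -
      have "{v. f v \<noteq> 0} \<subseteq> F" using that by (auto simp: subcomplex_def)
      moreover have "f \<in> realization_carrier V rel" using that by (simp add: subcomplex_def)
      ultimately show ?thesis using support_chain[of f] unfolding D_def by blast
    qed
    then show ?thesis using im by auto
  qed
  moreover have "openin Z {x \<in> topspace Z. \<phi> x \<in> - D}"
    using cont \<open>closed D\<close> by (auto simp: continuous_map)
  ultimately show "openin Z {x \<in> topspace Z. \<phi> x \<in> U}" by simp
qed

text \<open>The weak topology is finer than the product topology, since a product-open set has an
  open trace on every simplex.\<close>

lemma continuous_map_from_realization: "continuous_map realization euclidean id"
  unfolding continuous_map
proof (intro conjI allI impI)
  fix U :: "('v \<Rightarrow> real) set" assume "openin euclidean U"
  then have "openin (top_of_set S) (S \<inter> U)" for S by (auto simp: openin_open_Int)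
  moreover have "realization_carrier V rel \<inter> U \<inter> geom_simplex \<sigma> = geom_simplex \<sigma> \<inter> U"
    if "poset_chain V rel \<sigma>" for \<sigma>
    using simplex_subset_carrier[OF that] by auto
  ultimately have "realization_open V rel (realization_carrier V rel \<inter> U)"
    unfolding realization_open_iff by auto
  then show "openin realization {x \<in> topspace realization. id x \<in> U}"
    by (simp add: openin_realization Int_def)
qed auto

text \<open>One point is picked from each open simplex that the compact set meets.  A simplex has only finitely
  many faces, so every subset of the resulting set of points is closed.\<close>

lemma compactin_realization_subcomplex:
  assumes "compactin realization C"
  obtains F where "finite F" "C \<subseteq> subcomplex F"
proof -
  have C: "C \<subseteq> realization_carrier V rel" using compactin_subset_topspace[OF assms] by simp
  define supp where "supp = (\<lambda>f::'v\<Rightarrow>real. {v. f v \<noteq> 0})"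
  define D where "D = inv_into C supp ` (supp ` C)"
  have DC: "D \<subseteq> C" unfolding D_def by (auto intro: inv_into_into)
  have suppD: "supp ` D = supp ` C" unfolding D_def by (auto simp: image_image f_inv_into_f)
  have inj: "inj_on supp D"
    unfolding D_def by (auto simp: inj_on_def f_inv_into_f)
  have op: "openin realization (realization_carrier V rel - E)" if "E \<subseteq> D" for E
  proof -
    have "openin (top_of_set (geom_simplex \<sigma>)) ((realization_carrier V rel - E) \<inter> geom_simplex \<sigma>)"
      if \<sigma>: "poset_chain V rel \<sigma>" for \<sigma>
    proof -
      have "supp ` (E \<inter> geom_simplex \<sigma>) \<subseteq> Pow \<sigma>"
        by (auto simp: geom_simplex_def supp_def)
      then have "finite (supp ` (E \<inter> geom_simplex \<sigma>))"
        using \<sigma> by (meson finite_Pow_iff finite_subset poset_chain_def)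
      then have "finite (E \<inter> geom_simplex \<sigma>)"
        by (rule finite_imageD) (use inj \<open>E \<subseteq> D\<close> in \<open>auto intro: inj_on_subset\<close>)
      then have "closed (E \<inter> geom_simplex \<sigma>)"
      proof -
        have "closed {f}" for f :: "'v \<Rightarrow> real"
        proof -
          have "{f} = (\<Inter>v. {g. g v = f v})" by auto
          moreover have "closed {g. g v = f v}" for v
            by (intro closed_Collect_eq continuous_on_product_coordinates continuous_intros)
          ultimately show ?thesis by auto
        qed
        then have "closed (\<Union>f\<in>E \<inter> geom_simplex \<sigma>. {f})"
          using \<open>finite (E \<inter> geom_simplex \<sigma>)\<close> by (intro closed_UN) auto
        then show ?thesis by simp
      qed
      moreover have "(realization_carrier V rel - E) \<inter> geom_simplex \<sigma> = geom_simplex \<sigma> \<inter> - (E \<inter> geom_simplex \<sigma>)"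
        using simplex_subset_carrier[OF \<sigma>] by auto
      ultimately show ?thesis by (metis open_Compl openin_open_Int)
    qed
    then show ?thesis unfolding openin_realization realization_open_iff by auto
  qed
  have "finite D"
  proof -
    \<comment> \<open>Every member of this cover contains at most one point of \<open>D\<close>; the
      last one takes care of the points of \<open>C\<close> outside \<open>D\<close>. A finite
      subcover therefore bounds \<open>D\<close>.\<close>
    define \<U> where "\<U> = (\<lambda>d. realization_carrier V rel - (D - {d})) ` D \<union> {realization_carrier V rel - D}"
    have "\<forall>U\<in>\<U>. openin realization U" unfolding \<U>_def using op by auto
    moreover have "C \<subseteq> \<Union>\<U>" unfolding \<U>_def using C by fastforce
    ultimately obtain \<F> where \<F>: "finite \<F>" "\<F> \<subseteq> \<U>" "C \<subseteq> \<Union>\<F>"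
      using assms unfolding compactin_def by blast
    have "D \<subseteq> (\<Union>U\<in>\<F>. U \<inter> D)" using \<F>(3) DC by auto
    moreover have "finite (U \<inter> D)" if "U \<in> \<F>" for U
    proof -
      have "\<exists>d. U \<inter> D \<subseteq> {d}" using that \<F>(2) unfolding \<U>_def by auto
      then show ?thesis by (meson finite.emptyI finite_insert finite_subset)
    qed
    ultimately show ?thesis using \<F>(1) by (meson finite_UN_I finite_subset)
  qed
  show ?thesis
  proof
    show "finite (\<Union>(supp ` C))"
      unfolding suppD[symmetric]
      using \<open>finite D\<close> DC C carrier_finite_support by (auto simp: supp_def)
    show "C \<subseteq> subcomplex (\<Union>(supp ` C))"
      using C by (auto simp: subcomplex_def supp_def)
  qed
qed

section \<open>Edge paths\<close>

definition segment :: "('v \<Rightarrow> real) \<Rightarrow> ('v \<Rightarrow> real) \<Rightarrow> real \<Rightarrow> 'v \<Rightarrow> real" where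
  "segment a b t = (\<lambda>v. (1 - t) * a v + t * b v)"

definition vertex :: "'v \<Rightarrow> 'v \<Rightarrow> real" where
  "vertex v = (\<lambda>w. if w = v then 1 else 0)"

text \<open>Inside a finite subcomplex the product topology is the right one, so the theory of
  \<open>homotopic_paths\<close> applies. The diagonal case \<open>fin_homotopic p p\<close> says
  that \<open>p\<close> is a path with image in a finite subcomplex and serves as a side condition
  throughout.\<close>

definition fin_homotopic :: "(real \<Rightarrow> 'v \<Rightarrow> real) \<Rightarrow> (real \<Rightarrow> 'v \<Rightarrow> real) \<Rightarrow> bool" where
  "fin_homotopic p q \<longleftrightarrow> (\<exists>F. finite F \<and> homotopic_paths (subcomplex F) p q)"

lemma segment_0 [simp]: "segment a b 0 = a" and segment_1 [simp]: "segment a b 1 = b"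
  by (simp_all add: segment_def)

lemma segment_refl [simp]: "segment a a = (\<lambda>_. a)"
  by (auto simp: segment_def algebra_simps)

lemma path_segment [simp]: "path (segment a b)"
  unfolding path_def segment_def by (intro continuous_intros)

lemma pathstart_segment [simp]: "pathstart (segment a b) = a"
  and pathfinish_segment [simp]: "pathfinish (segment a b) = b"
  by (simp_all add: pathstart_def pathfinish_def)

lemma segment_in_simplex:
  assumes "a \<in> geom_simplex \<sigma>" "b \<in> geom_simplex \<sigma>" "t \<in> {0..1}"
  shows "segment a b t \<in> geom_simplex \<sigma>"
proof -
  have "sum (segment a b t) \<sigma> = (1 - t) * sum a \<sigma> + t * sum b \<sigma>"
    by (simp add: segment_def sum.distrib sum_distrib_left)
  then show ?thesis using assms by (auto simp: geom_simplex_def segment_def)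
qed

lemma vertex_in_simplex: "finite \<sigma> \<Longrightarrow> v \<in> \<sigma> \<Longrightarrow> vertex v \<in> geom_simplex \<sigma>"
  by (auto simp: geom_simplex_def vertex_def)

lemma fin_homotopic_refl: "fin_homotopic p p \<longleftrightarrow> path p \<and> (\<exists>F. finite F \<and> path_image p \<subseteq> subcomplex F)"
  by (auto simp: fin_homotopic_def)

lemma fin_homotopic_sym: "fin_homotopic p q \<Longrightarrow> fin_homotopic q p"
  by (auto simp: fin_homotopic_def intro: homotopic_paths_sym)

text \<open>Homotopies survive enlarging the subcomplex, so the union of the two finite vertex sets
  serves both.\<close>

lemma fin_homotopic_common:
  assumes "fin_homotopic p q" "fin_homotopic p' q'"
  obtains F where "finite F" "homotopic_paths (subcomplex F) p q" "homotopic_paths (subcomplex F) p' q'"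
proof -
  obtain F1 F2 where F: "finite F1" "homotopic_paths (subcomplex F1) p q"
    "finite F2" "homotopic_paths (subcomplex F2) p' q'"
    using assms by (auto simp: fin_homotopic_def)
  show thesis
    by (rule that[of "F1 \<union> F2"])
      (use F in \<open>auto intro: homotopic_paths_subset[OF _ subcomplex_mono]\<close>)
qed

lemma fin_homotopic_trans [trans]: "fin_homotopic p q \<Longrightarrow> fin_homotopic q r \<Longrightarrow> fin_homotopic p r"
  by (erule (1) fin_homotopic_common) (auto simp: fin_homotopic_def intro: homotopic_paths_trans)

lemma fin_homotopic_imp_start: "fin_homotopic p q \<Longrightarrow> pathstart p = pathstart q"
  and fin_homotopic_imp_finish: "fin_homotopic p q \<Longrightarrow> pathfinish p = pathfinish q"
  by (auto simp: fin_homotopic_def dest: homotopic_paths_imp_pathstart homotopic_paths_imp_pathfinish)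

lemma fin_homotopic_imp_refl: "fin_homotopic p q \<Longrightarrow> fin_homotopic p p" "fin_homotopic p q \<Longrightarrow> fin_homotopic q q"
  by (blast intro: fin_homotopic_sym fin_homotopic_trans)+

lemma fin_homotopic_join:
  "fin_homotopic p p' \<Longrightarrow> fin_homotopic q q' \<Longrightarrow> pathfinish p = pathstart q \<Longrightarrow> fin_homotopic (p +++ q) (p' +++ q')"
  by (erule (1) fin_homotopic_common) (auto simp: fin_homotopic_def intro: homotopic_paths_join)

lemma fin_homotopic_assoc:
  assumes "fin_homotopic p p" "fin_homotopic q q" "fin_homotopic r r" "pathfinish p = pathstart q" "pathfinish q = pathstart r"
  shows "fin_homotopic (p +++ (q +++ r)) ((p +++ q) +++ r)"
proof -
  obtain F1 where F1: "finite F1" "path p" "path_image p \<subseteq> subcomplex F1" using assms by (auto simp: fin_homotopic_refl)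
  obtain F2 where F2: "finite F2" "path q" "path_image q \<subseteq> subcomplex F2" using assms by (auto simp: fin_homotopic_refl)
  obtain F3 where F3: "finite F3" "path r" "path_image r \<subseteq> subcomplex F3" using assms by (auto simp: fin_homotopic_refl)
  let ?F = "F1 \<union> F2 \<union> F3"
  have "subcomplex F1 \<subseteq> subcomplex ?F" "subcomplex F2 \<subseteq> subcomplex ?F" "subcomplex F3 \<subseteq> subcomplex ?F"
    by (intro subcomplex_mono; blast)+
  then have "homotopic_paths (subcomplex ?F) (p +++ (q +++ r)) ((p +++ q) +++ r)"
    using F1 F2 F3 assms(4,5) by (intro homotopic_paths_assoc) auto
  then show ?thesis unfolding fin_homotopic_def using F1(1) F2(1) F3(1) by (intro exI[of _ ?F]) auto
qed

lemma fin_homotopic_reversepath: "fin_homotopic p p \<Longrightarrow> fin_homotopic (reversepath p) (reversepath p)"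
  by (simp add: fin_homotopic_refl)

text \<open>A convex set is simply connected, and \<open>M\<close> transports the homotopy between
  \<open>r\<close> and \<open>r'\<close>. Reparametrizations use an interval as \<open>S\<close>,
  cones use a square.\<close>

lemma fin_homotopic_convex_image:
  fixes S :: "'e::real_normed_vector set"
  assumes "convex S" "continuous_on S M" "M ` S \<subseteq> subcomplex F" "finite F"
    and "path r" "path_image r \<subseteq> S" "path r'" "path_image r' \<subseteq> S"
    and "pathstart r = pathstart r'" "pathfinish r = pathfinish r'"
  shows "fin_homotopic (M \<circ> r) (M \<circ> r')"
proof -
  have "homotopic_paths S r r'"
    using convex_imp_simply_connected[OF assms(1)] assms(5-)
    unfolding simply_connected_eq_homotopic_paths by auto
  then have "homotopic_paths (subcomplex F) (M \<circ> r) (M \<circ> r')"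
    using assms(2,3) by (intro homotopic_paths_continuous_image) auto
  then show ?thesis using assms(4) by (auto simp: fin_homotopic_def)
qed

lemma fin_homotopic_reparam:
  assumes "fin_homotopic p p" "path r" "path_image r \<subseteq> {0..1}" "path r'" "path_image r' \<subseteq> {0..1}"
    and "pathstart r = pathstart r'" "pathfinish r = pathfinish r'"
  shows "fin_homotopic (p \<circ> r) (p \<circ> r')"
proof -
  obtain F where "finite F" "path p" "p ` {0..1} \<subseteq> subcomplex F"
    using assms(1) by (auto simp: fin_homotopic_refl path_image_def)
  then show ?thesis
    using assms by (intro fin_homotopic_convex_image[of "{0..1}"]) (auto simp: path_def)
qed

section \<open>Unit and inverse laws by reparametrization, and cones\<close>

lemma linepath_eq_id: "linepath (0::real) 1 = id"
  by (auto simp: linepath_def)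

lemma path_image_linepath_01: "a \<in> {0..1} \<Longrightarrow> b \<in> {0..1} \<Longrightarrow> path_image (linepath a b) \<subseteq> {0..1::real}"
  by (simp add: closed_segment_subset)

lemma fin_homotopic_rid:
  assumes "fin_homotopic p p"
  shows "fin_homotopic (p +++ (\<lambda>_. pathfinish p)) p"
proof -
  \<comment> \<open>The left path runs through \<open>p\<close> and then rests at its end; both
    parameter paths lead from 0 to 1.\<close>
  have "fin_homotopic (p \<circ> (linepath 0 1 +++ linepath 1 1)) (p \<circ> linepath 0 1)"
    by (intro fin_homotopic_reparam assms path_join_imp subset_path_image_join path_image_linepath_01) auto
  moreover have "p \<circ> linepath 1 1 = (\<lambda>_. pathfinish p)" by (auto simp: linepath_def pathfinish_def)
  ultimately show ?thesis by (simp only: path_compose_join) (simp add: linepath_eq_id)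
qed

lemma fin_homotopic_rinv:
  assumes "fin_homotopic p p"
  shows "fin_homotopic (p +++ reversepath p) (\<lambda>_. pathstart p)"
proof -
  \<comment> \<open>The parameter runs from 0 to 1 and back, which contracts within the interval to
    resting at 0.\<close>
  have "fin_homotopic (p \<circ> (linepath 0 1 +++ linepath 1 0)) (p \<circ> linepath 0 0)"
    by (intro fin_homotopic_reparam assms path_join_imp subset_path_image_join path_image_linepath_01) auto
  moreover have "p \<circ> linepath 0 0 = (\<lambda>_. pathstart p)" by (auto simp: linepath_def pathstart_def)
  moreover have "p \<circ> linepath 1 0 = reversepath p" by (auto simp: linepath_def reversepath_def)
  ultimately show ?thesis by (simp only: path_compose_join) (simp add: linepath_eq_id)
qed

text \<open>The map from the square sends (s, t) to the point at parameter t on the segment from p s to w;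
  the two paths are images of two boundary paths of the square from (0, 0) to (1, 1).\<close>

lemma fin_homotopic_cone:
  assumes p: "fin_homotopic p p" and F: "finite F"
    and cone: "\<And>s t. s \<in> {0..1} \<Longrightarrow> t \<in> {0..1} \<Longrightarrow> segment (p s) w t \<in> subcomplex F"
  shows "fin_homotopic (p +++ segment (pathfinish p) w) (segment (pathstart p) w)"
proof -
  define M where "M = (\<lambda>(s, t). segment (p s) w t)"
  define S where "S = {0..1::real} \<times> {0..1::real}"
  have "continuous_on {0..1} p" using p by (simp add: fin_homotopic_refl path_def)
  then have "continuous_on {0..1} (\<lambda>s. p s v)" for v
    by (rule continuous_on_product_then_coordinatewise)
  then have "continuous_on S (\<lambda>z. p (fst z) v)" for v
    by (rule continuous_on_compose2[of _ _ _ fst]) (auto simp: S_def intro: continuous_intros)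
  then have M: "continuous_on S M" unfolding M_def segment_def case_prod_beta
    by (intro continuous_intros)
  have im: "M ` S \<subseteq> subcomplex F" using cone by (auto simp: M_def S_def)
  have S: "convex S" unfolding S_def by (intro convex_Times) auto
  have line: "path_image (linepath x y) \<subseteq> S" if "x \<in> S" "y \<in> S" for x y
    using S that by (simp add: closed_segment_subset)
  have *: "fin_homotopic (M \<circ> (linepath (0,0) (1,0) +++ linepath (1,0) (1,1)))
              (M \<circ> (linepath (0,0) (0,1) +++ linepath (0,1) (1,1)))"
    by (intro fin_homotopic_convex_image[OF S M im F] path_join_imp subset_path_image_join line)
       (auto simp: S_def)
  have "M \<circ> linepath (0,0) (1,0) = p" "M \<circ> linepath (1,0) (1,1) = segment (pathfinish p) w"
    "M \<circ> linepath (0,0) (0,1) = segment (pathstart p) w" "M \<circ> linepath (0,1) (1,1) = (\<lambda>_. w)"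
    by (auto simp: M_def linepath_def pathstart_def pathfinish_def)
  then have *: "fin_homotopic (p +++ segment (pathfinish p) w) (segment (pathstart p) w +++ (\<lambda>_. w))"
    using * by (simp only: path_compose_join)
  have "segment (p 0) w ` {0..1} \<subseteq> subcomplex F" using cone[of 0] by auto
  then have "fin_homotopic (segment (pathstart p) w) (segment (pathstart p) w)"
    using F by (auto simp: fin_homotopic_refl path_image_def pathstart_def)
  from fin_homotopic_rid[OF this] * show ?thesis by (auto intro: fin_homotopic_trans)
qed

section \<open>Segments in simplexes and edge paths as lists of vertices\<close>

lemma fin_homotopic_segment:
  assumes "poset_chain V rel \<sigma>" "a \<in> geom_simplex \<sigma>" "b \<in> geom_simplex \<sigma>"
  shows "fin_homotopic (segment a b) (segment a b)"
proof -
  have "path_image (segment a b) \<subseteq> subcomplex \<sigma>"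
    using segment_in_simplex[OF assms(2,3)] simplex_subset_subcomplex[OF assms(1) order_refl]
    unfolding path_image_def by blast
  then show ?thesis using assms(1) by (auto simp: fin_homotopic_refl poset_chain_def)
qed

text \<open>This is the cone from \<open>c\<close> over the segment from \<open>a\<close> to
  \<open>b\<close>; it stays in the simplex by convexity.\<close>

lemma fin_homotopic_triangle:
  assumes "poset_chain V rel \<sigma>" "a \<in> geom_simplex \<sigma>" "b \<in> geom_simplex \<sigma>" "c \<in> geom_simplex \<sigma>"
  shows "fin_homotopic (segment a b +++ segment b c) (segment a c)"
proof -
  have "finite \<sigma>" using assms(1) by (simp add: poset_chain_def)
  moreover have "segment (segment a b s) c t \<in> subcomplex \<sigma>" if "s \<in> {0..1}" "t \<in> {0..1}" for s t
    using that assms simplex_subset_subcomplex[OF assms(1) order_refl] by (blast intro: segment_in_simplex)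
  ultimately show ?thesis using fin_homotopic_cone[OF fin_homotopic_segment[OF assms(1-3)], of \<sigma> c] by simp
qed

text \<open>The value at \<open>[]\<close> is a dummy. A one-vertex list gives a constant path, so
  every longer polygon ends with a constant piece.\<close>

fun polygon :: "'v list \<Rightarrow> real \<Rightarrow> 'v \<Rightarrow> real" where
  "polygon [] = (\<lambda>_ _. 0)"
| "polygon [v] = (\<lambda>_. vertex v)"
| "polygon (u # v # l) = segment (vertex u) (vertex v) +++ polygon (v # l)"

text \<open>Consecutive vertices may coincide, because \<open>{u, v}\<close> is then a one-element
  chain; such degenerate edges are used below to insert a vertex.\<close>

fun edge_path :: "'v list \<Rightarrow> bool" where
  "edge_path [] \<longleftrightarrow> False"
| "edge_path [v] \<longleftrightarrow> poset_chain V rel {v}"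
| "edge_path (u # v # l) \<longleftrightarrow> poset_chain V rel {u, v} \<and> edge_path (v # l)"

lemma pathstart_polygon [simp]: "l \<noteq> [] \<Longrightarrow> pathstart (polygon l) = vertex (hd l)"
  by (induction l rule: polygon.induct) (auto simp: pathstart_def joinpaths_def)

lemma pathfinish_polygon [simp]: "l \<noteq> [] \<Longrightarrow> pathfinish (polygon l) = vertex (last l)"
  by (induction l rule: polygon.induct) (simp_all, simp add: pathfinish_def)

lemma chain_finite: "poset_chain V rel \<sigma> \<Longrightarrow> finite \<sigma>"
  by (simp add: poset_chain_def)

lemma chain_subset: "poset_chain V rel \<sigma> \<Longrightarrow> \<tau> \<subseteq> \<sigma> \<Longrightarrow> \<tau> \<noteq> {} \<Longrightarrow> poset_chain V rel \<tau>"
  by (auto simp: poset_chain_def intro: finite_subset)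

lemma fin_homotopic_polygon: "edge_path l \<Longrightarrow> fin_homotopic (polygon l) (polygon l)"
proof (induction l rule: polygon.induct)
  case (2 v)
  then show ?case
    using fin_homotopic_segment[of "{v}" "vertex v" "vertex v"] vertex_in_simplex[of "{v}" v]
    by simp
next
  case (3 u v l)
  then show ?case
    by (auto intro!: fin_homotopic_join fin_homotopic_segment[of "{u,v}"] vertex_in_simplex)
qed auto

text \<open>Equality of the heads is recorded for the lists themselves, so that a vertex can be put
  in front of both in \<open>edge_homotopic_Cons\<close>.\<close>

definition edge_homotopic :: "'v list \<Rightarrow> 'v list \<Rightarrow> bool" where
  "edge_homotopic l l' \<longleftrightarrow> edge_path l \<and> edge_path l' \<and> hd l = hd l' \<and> fin_homotopic (polygon l) (polygon l')"

lemma edge_homotopic_sym: "edge_homotopic l l' \<Longrightarrow> edge_homotopic l' l"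
  by (auto simp: edge_homotopic_def fin_homotopic_sym)

lemma edge_homotopic_trans [trans]: "edge_homotopic l l' \<Longrightarrow> edge_homotopic l' l'' \<Longrightarrow> edge_homotopic l l''"
  by (auto simp: edge_homotopic_def intro: fin_homotopic_trans)

lemma edge_homotopic_Cons:
  assumes "poset_chain V rel {u, hd l}" "edge_homotopic l l'"
  shows "edge_homotopic (u # l) (u # l')"
proof -
  obtain v m m' where "l = v # m" "l' = v # m'"
    using assms(2) by (cases l; cases l') (auto simp: edge_homotopic_def)
  then show ?thesis
    using assms by (auto simp: edge_homotopic_def intro!: fin_homotopic_join fin_homotopic_segment[of "{u,v}"] vertex_in_simplex)
qed

text \<open>The elementary move on edge paths: the detour through \<open>v\<close> is pushed across
  the simplex on \<open>u\<close>, \<open>v\<close>, \<open>w\<close>. Coincidences among the three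
  vertices are allowed.\<close>

lemma edge_homotopic_triangle:
  assumes "poset_chain V rel {u, v, w}" "edge_path (w # l)"
  shows "edge_homotopic (u # v # w # l) (u # w # l)"
proof -
  have v: "vertex x \<in> geom_simplex {u, v, w}" if "x \<in> {u, v, w}" for x
    using that by (intro vertex_in_simplex) auto
  have "fin_homotopic (segment (vertex u) (vertex v) +++ (segment (vertex v) (vertex w) +++ polygon (w # l)))
           ((segment (vertex u) (vertex v) +++ segment (vertex v) (vertex w)) +++ polygon (w # l))"
    using assms v by (intro fin_homotopic_assoc fin_homotopic_segment[OF assms(1)] fin_homotopic_polygon) auto
  also have "fin_homotopic \<dots> (segment (vertex u) (vertex w) +++ polygon (w # l))"
    using assms v by (intro fin_homotopic_join fin_homotopic_triangle[OF assms(1)] fin_homotopic_polygon) auto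
  finally show ?thesis
    using assms by (auto simp: edge_homotopic_def intro: chain_subset[OF assms(1)])
qed

text \<open>The paths \<open>c v\<close> extend to paths \<open>Q a\<close> from every point
  \<open>a\<close> to the vertex of \<open>b\<close>. Moving \<open>a\<close> along a loop
  \<open>g\<close> changes \<open>Q a\<close> only by the traversed piece of \<open>g\<close>, so
  \<open>g\<close> followed by \<open>Q (g 0)\<close> is homotopic to \<open>Q (g 0)\<close>, and
  cancelling \<open>Q (g 0)\<close> contracts \<open>g\<close>.\<close>

theorem simply_connected_realization:
  assumes c: "\<And>v. poset_chain V rel {v} \<Longrightarrow> edge_path (c v) \<and> hd (c v) = v \<and> last (c v) = b"
    and hom: "\<And>u v. poset_chain V rel {u, v} \<Longrightarrow> edge_homotopic (u # c v) (c u)"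
  shows "simply_connected_space realization"
proof -
  \<comment> \<open>From \<open>a\<close> the path goes straight to a vertex \<open>v\<close> of the
    simplex carrying \<open>a\<close> and then follows \<open>c v\<close>. \<open>Q\<close> fixes
    one such vertex by choice; up to homotopy the choice is irrelevant.\<close>
  define q where "q = (\<lambda>a v. segment a (vertex v) +++ polygon (c v))"
  define Q where "Q = (\<lambda>a. q a (SOME v. a v \<noteq> 0))"
  have c': "edge_path (c v)" "c v \<noteq> []" "hd (c v) = v" "last (c v) = b" if "poset_chain V rel {v}" for v
    using c[OF that] by auto
  have supp: "poset_chain V rel {v}" "vertex v \<in> geom_simplex {v. a v \<noteq> 0}"
    if "a \<in> realization_carrier V rel" "a v \<noteq> 0" for a v
    using support_chain(1)[OF that(1)] that by (auto intro: vertex_in_simplex chain_finite chain_subset)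
  \<comment> \<open>The triangle on \<open>a\<close>, \<open>u\<close>, \<open>v\<close> compares
    the first pieces, the hypothesis \<open>hom\<close> the remaining ones.\<close>
  have indep: "fin_homotopic (q a u) (q a v)"
    if a: "a \<in> realization_carrier V rel" and uv: "a u \<noteq> 0" "a v \<noteq> 0" for a u v
  proof -
    let ?\<sigma> = "{v. a v \<noteq> 0}"
    note \<sigma> = support_chain[OF a]
    note u = supp[OF a uv(1)] and v = supp[OF a uv(2)]
    have "poset_chain V rel {u, v}" using uv by (intro chain_subset[OF \<sigma>(1)]) auto
    from hom[OF this] have h: "fin_homotopic (polygon (c u)) (polygon (u # c v))" by (auto simp: edge_homotopic_def fin_homotopic_sym)
    have l: "polygon (u # c v) = segment (vertex u) (vertex v) +++ polygon (c v)"
      using c'[OF v(1)] by (cases "c v") auto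
    have "fin_homotopic (q a u) (segment a (vertex u) +++ (segment (vertex u) (vertex v) +++ polygon (c v)))"
      unfolding q_def using h c'[OF u(1)] \<sigma> u unfolding l by (intro fin_homotopic_join fin_homotopic_segment[OF \<sigma>(1)]) auto
    also have "fin_homotopic \<dots> ((segment a (vertex u) +++ segment (vertex u) (vertex v)) +++ polygon (c v))"
      using \<sigma> u v c'[OF v(1)] by (intro fin_homotopic_assoc fin_homotopic_segment[OF \<sigma>(1)] fin_homotopic_polygon) auto
    also have "fin_homotopic \<dots> (q a v)"
      unfolding q_def using \<sigma> u v c'[OF v(1)] by (intro fin_homotopic_join fin_homotopic_triangle[OF \<sigma>(1)] fin_homotopic_polygon) auto
    finally show ?thesis .
  qed
  have ex: "\<exists>v. a v \<noteq> 0" if "a \<in> realization_carrier V rel" for a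
    using support_chain(1)[OF that] by (auto simp: poset_chain_def)
  have Q: "fin_homotopic (q a v) (Q a)" if "a \<in> realization_carrier V rel" "a v \<noteq> 0" for a v
    unfolding Q_def by (rule indep[OF that]) (use ex[OF that(1)] in \<open>rule someI_ex\<close>)
  have Q_ends: "pathstart (Q a) = a" "pathfinish (Q a) = vertex b" "fin_homotopic (Q a) (Q a)"
    if a: "a \<in> realization_carrier V rel" for a
  proof -
    obtain v where v: "a v \<noteq> 0" using ex[OF a] by auto
    show "fin_homotopic (Q a) (Q a)" using Q[OF a v] by (rule fin_homotopic_imp_refl)
    show "pathstart (Q a) = a" using fin_homotopic_imp_start[OF Q[OF a v]] by (simp add: q_def)
    show "pathfinish (Q a) = vertex b"
      using fin_homotopic_imp_finish[OF Q[OF a v]] c'[OF supp(1)[OF a v]] by (simp add: q_def)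
  qed
  have pathin: "pathin realization p" if p: "fin_homotopic p p" for p
  proof -
    obtain F where F: "finite F" "continuous_on {0..1} p" "p ` {0..1} \<subseteq> subcomplex F"
      using p by (auto simp: fin_homotopic_refl path_def path_image_def)
    then show ?thesis
      unfolding pathin_def by (intro continuous_map_into_realization[of _ _ F]) auto
  qed
  have contract: "homotopic_with (\<lambda>h. h 0 = g 0 \<and> h 1 = g 0) (top_of_set {0..1}) realization g (\<lambda>t. g 0)"
    if g: "pathin realization g" "g 1 = g 0" for g
  proof -
    have "compactin realization (g ` {0..1})"
      using g(1) unfolding pathin_def
      by (rule image_compactin[rotated]) (simp add: compactin_subtopology)
    then obtain F where F: "finite F" "g ` {0..1} \<subseteq> subcomplex F"
      by (rule compactin_realization_subcomplex)
    have cont: "continuous_on {0..1} g"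
      using continuous_map_compose[OF g(1)[unfolded pathin_def] continuous_map_from_realization] by simp
    then have gg: "fin_homotopic g g" using F by (auto simp: fin_homotopic_refl path_def path_image_def)
    have gc: "g t \<in> realization_carrier V rel" "g t \<in> subcomplex F" if "t \<in> {0..1}" for t
      using F(2) that unfolding subcomplex_def by blast+
    have sub: "fin_homotopic (g \<circ> linepath s t) (g \<circ> linepath s t)" if "s \<in> {0..1}" "t \<in> {0..1}" for s t
      using that by (intro fin_homotopic_reparam gg path_image_linepath_01) auto
    have sub_ends: "pathstart (g \<circ> linepath s t) = g s" "pathfinish (g \<circ> linepath s t) = g t" for s t
      by (simp_all add: pathstart_compose pathfinish_compose)
    \<comment> \<open>\<open>P\<close> is additive over adjacent intervals and holds on all short
      intervals around a point, so bisection gives it on the whole of [0,1].\<close>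
    define P where "P = (\<lambda>s t. 0 \<le> s \<longrightarrow> s \<le> t \<longrightarrow> t \<le> 1 \<longrightarrow> fin_homotopic ((g \<circ> linepath s t) +++ Q (g t)) (Q (g s)))"
    have "P 0 1"
    proof (rule Bolzano)
      show "P x z" if "P x y" "P y z" "x \<le> y" "y \<le> z" for x y z
        unfolding P_def
      proof (intro impI)
        assume "0 \<le> x" "x \<le> z" "z \<le> 1"
        then have x: "x \<in> {0..1}" and y: "y \<in> {0..1}" and z: "z \<in> {0..1}" using that by auto
        note carr = gc(1)[OF x] gc(1)[OF y] gc(1)[OF z]
        have "fin_homotopic (g \<circ> linepath x z) (g \<circ> (linepath x y +++ linepath y z))"
          using x y z by (intro fin_homotopic_reparam gg path_join_imp subset_path_image_join path_image_linepath_01) auto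
        then have "fin_homotopic ((g \<circ> linepath x z) +++ Q (g z)) (((g \<circ> linepath x y) +++ (g \<circ> linepath y z)) +++ Q (g z))"
          using carr by (intro fin_homotopic_join Q_ends) (auto simp: path_compose_join sub_ends Q_ends)
        also have "fin_homotopic \<dots> ((g \<circ> linepath x y) +++ ((g \<circ> linepath y z) +++ Q (g z)))"
          using carr x y z by (intro fin_homotopic_sym[OF fin_homotopic_assoc] sub Q_ends) (auto simp: sub_ends Q_ends)
        also have "fin_homotopic \<dots> ((g \<circ> linepath x y) +++ Q (g y))"
          using carr x y z that by (intro fin_homotopic_join sub) (auto simp: sub_ends P_def)
        also have "fin_homotopic \<dots> (Q (g x))" using x y that by (auto simp: P_def)
        finally show "fin_homotopic ((g \<circ> linepath x z) +++ Q (g z)) (Q (g x))" .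
      qed
    next
      fix x :: real assume "0 \<le> x" "x \<le> 1"
      then have x: "x \<in> {0..1}" by simp
      \<comment> \<open>By continuity the coordinate at \<open>v\<close> stays nonzero near
        \<open>x\<close>: the loop remains in the open star of \<open>v\<close>, where it can be
        coned off to \<open>v\<close>.\<close>
      obtain v where v: "g x v \<noteq> 0" using ex[OF gc(1)[OF x]] by auto
      have "continuous_on {0..1} (\<lambda>t. g t v)"
        using cont by (rule continuous_on_product_then_coordinatewise)
      then obtain d where d: "d > 0" "\<And>t. t \<in> {0..1} \<Longrightarrow> dist t x < d \<Longrightarrow> dist (g t v) (g x v) < \<bar>g x v\<bar>"
        using x v unfolding continuous_on_iff by (metis zero_less_abs_iff)
      have "P s t" if st: "s \<le> x" "x \<le> t" "t - s < d" for s t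
        unfolding P_def
      proof (intro impI)
        assume "0 \<le> s" "s \<le> t" "t \<le> 1"
        then have s: "s \<in> {0..1}" and t: "t \<in> {0..1}" by auto
        have nz: "g r v \<noteq> 0" if "r \<in> {s..t}" for r
        proof -
          have "r \<in> {0..1}" "dist r x < d" using that s t st by (auto simp: dist_real_def)
          then show ?thesis using d(2)[of r] by (auto simp: dist_real_def)
        qed
        have nzs: "g s v \<noteq> 0" and nzt: "g t v \<noteq> 0" using nz \<open>s \<le> t\<close> by auto
        note carr = gc(1)[OF s] gc(1)[OF t]
        have cone: "segment ((g \<circ> linepath s t) r) (vertex v) r' \<in> subcomplex F"
          if "r \<in> {0..1}" "r' \<in> {0..1}" for r r'
        proof -
          define y where "y = linepath s t r"
          have y: "y \<in> {s..t}"
            using linepath_in_path[OF that(1), of s t] \<open>s \<le> t\<close> by (simp add: y_def closed_segment_eq_real_ivl)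
          then have y01: "y \<in> {0..1}" using s t by auto
          \<comment> \<open>Since \<open>v\<close> lies in the support of \<open>g y\<close>, the
            segment to it stays in the simplex on that support, and this simplex lies in
            \<open>subcomplex F\<close>.\<close>
          have "{v. g y v \<noteq> 0} \<subseteq> F" using gc(2)[OF y01] by (auto simp: subcomplex_def)
          then have "geom_simplex {v. g y v \<noteq> 0} \<subseteq> subcomplex F"
            by (intro simplex_subset_subcomplex support_chain gc y01)
          moreover have "segment (g y) (vertex v) r' \<in> geom_simplex {v. g y v \<noteq> 0}"
            using that(2) by (intro segment_in_simplex support_chain gc y01 supp nz y) auto
          ultimately show ?thesis by (auto simp: y_def)
        qed
        have "fin_homotopic ((g \<circ> linepath s t) +++ segment (g t) (vertex v)) (segment (g s) (vertex v))"
          using fin_homotopic_cone[OF sub[OF s t] F(1) cone] by (simp only: sub_ends)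
        note cone' = this
        have cv: "poset_chain V rel {v}" using supp[OF carr(1) nzs] by simp
        have "fin_homotopic ((g \<circ> linepath s t) +++ Q (g t)) ((g \<circ> linepath s t) +++ q (g t) v)"
          using carr nzt by (intro fin_homotopic_join sub s t fin_homotopic_sym[OF Q]) (auto simp: sub_ends Q_ends)
        also have "fin_homotopic \<dots> (((g \<circ> linepath s t) +++ segment (g t) (vertex v)) +++ polygon (c v))"
          unfolding q_def using carr nzt c'[OF cv]
          by (intro fin_homotopic_assoc sub s t fin_homotopic_polygon fin_homotopic_segment[OF support_chain(1)[OF carr(2)]] supp(2) support_chain)
             (auto simp: sub_ends)
        also have "fin_homotopic \<dots> (q (g s) v)"
          unfolding q_def using c'[OF cv] by (intro fin_homotopic_join cone' fin_homotopic_polygon) auto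
        also have "fin_homotopic \<dots> (Q (g s))" by (intro Q carr nzs)
        finally show "fin_homotopic ((g \<circ> linepath s t) +++ Q (g t)) (Q (g s))" .
      qed
      then show "\<exists>d>0. \<forall>a b. a \<le> x \<and> x \<le> b \<and> b - a < d \<longrightarrow> P a b" using d(1) by blast
    qed auto
    then have key: "fin_homotopic (g +++ Q (g 0)) (Q (g 0))" using g(2) by (simp add: P_def linepath_eq_id)
    have carr: "g 0 \<in> realization_carrier V rel" by (rule gc) auto
    note Q0 = Q_ends[OF carr]
    have ends: "pathstart g = g 0" "pathfinish g = g 0" using g(2) by (auto simp: pathstart_def pathfinish_def)
    let ?k = "\<lambda>_. g 0"
    \<comment> \<open>Cancellation of \<open>Q (g 0)\<close>: its product with its reverse is
      inserted after \<open>g\<close>, and \<open>key\<close> then absorbs \<open>g\<close>.\<close>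
    have "fin_homotopic g (g +++ ?k)" using fin_homotopic_sym[OF fin_homotopic_rid[OF gg]] ends by simp
    also have "fin_homotopic \<dots> (g +++ (Q (g 0) +++ reversepath (Q (g 0))))"
      using fin_homotopic_sym[OF fin_homotopic_rinv[OF Q0(3)]] Q0 ends by (intro fin_homotopic_join gg) (auto simp: pathstart_def)
    also have "fin_homotopic \<dots> ((g +++ Q (g 0)) +++ reversepath (Q (g 0)))"
      using Q0 ends by (intro fin_homotopic_assoc gg fin_homotopic_reversepath) auto
    also have "fin_homotopic \<dots> (Q (g 0) +++ reversepath (Q (g 0)))"
      using Q0 ends by (intro fin_homotopic_join key fin_homotopic_reversepath) auto
    also have "fin_homotopic \<dots> ?k" using fin_homotopic_rinv[OF Q0(3)] Q0 by simp
    finally obtain F' where F': "finite F'" "homotopic_paths (subcomplex F') g ?k"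
      by (auto simp: fin_homotopic_def)
    \<comment> \<open>The homotopy lives in the product topology of a finite subcomplex; the
      inclusion carries it to the weak topology.\<close>
    have "continuous_map (top_of_set (subcomplex F')) realization id"
      using F'(1) by (intro continuous_map_into_realization[of _ _ F']) auto
    from homotopic_with_compose_continuous_map_left[OF F'(2)[unfolded homotopic_paths_def] this,
        of "\<lambda>h. h 0 = g 0 \<and> h 1 = g 0"]
    show ?thesis using g(2) by (auto simp: pathstart_def pathfinish_def)
  qed
  have "path_connected_space realization"
    unfolding path_connected_space_def
  proof (intro ballI)
    fix x y assume "x \<in> topspace realization" "y \<in> topspace realization"
    then have xy: "x \<in> realization_carrier V rel" "y \<in> realization_carrier V rel" by auto
    have "pathin realization (Q x +++ reversepath (Q y))"
      using Q_ends xy by (intro pathin fin_homotopic_join fin_homotopic_reversepath) auto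
    moreover have "(Q x +++ reversepath (Q y)) 0 = x" "(Q x +++ reversepath (Q y)) 1 = y"
      using Q_ends(1)[OF xy(1)] Q_ends(1)[OF xy(2)] by (auto simp: joinpaths_def pathstart_def reversepath_def)
    ultimately show "\<exists>g. pathin realization g \<and> g 0 = x \<and> g 1 = y" by blast
  qed
  with contract show ?thesis by (auto simp: simply_connected_space_def)
qed

section \<open>A map to the circle\<close>

lemma polygon_eq_one:
  fixes e :: "('v \<Rightarrow> real) \<Rightarrow> complex"
  assumes "\<And>v. e (vertex v) = 1" "l \<noteq> []"
    and "successively (\<lambda>u v. \<forall>t. e (segment (vertex u) (vertex v) t) = 1) l"
  shows "e (polygon l t) = 1"
  using assms(2,3)
proof (induction l arbitrary: t rule: polygon.induct)
  case (3 u v l)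
  then show ?case by (simp add: joinpaths_def)
qed (auto simp: assms(1))

text \<open>The function below sends f to exp(2 pi i w), where w is the weight of f on W, on the simplices that
  meet both U and W, and to 1 elsewhere.  It maps a loop that crosses from U to W once onto the circle.\<close>

theorem not_simply_connected_realization:
  assumes disj: "U \<inter> W = {}"
    and cut: "\<And>x y z. poset_chain V rel {x, y, z} \<Longrightarrow> x \<in> U \<Longrightarrow> y \<in> W \<Longrightarrow> z \<in> U \<union> W"
    and l: "edge_path l" "hd l \<in> W" "last l \<in> U" "poset_chain V rel {last l, hd l}"
    and no_cross: "successively (\<lambda>u v. \<not> (u \<in> U \<and> v \<in> W) \<and> \<not> (u \<in> W \<and> v \<in> U)) l"
  shows "\<not> simply_connected_space realization"
proof
  assume sc: "simply_connected_space realization"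
  \<comment> \<open>Restricting to nonzero coordinates makes the sum finite at every point of the
    realization, even for infinite \<open>W\<close>.\<close>
  define wt where "wt = (\<lambda>f::'v \<Rightarrow> real. \<Sum>v | v \<in> W \<and> f v \<noteq> 0. f v)"
  define e where "e = (\<lambda>f. if \<exists>v\<in>U. f v \<noteq> 0 then exp (2 * pi * \<i> * of_real (wt f)) else 1)"
  have e_noU: "e f = 1" if "\<And>v. v \<in> U \<Longrightarrow> f v = 0" for f using that by (auto simp: e_def)
  have e_noW: "e f = 1" if "\<And>v. v \<in> W \<Longrightarrow> f v = 0" for f
  proof -
    have "{v \<in> W. f v \<noteq> 0} = {}" using that by auto
    then show ?thesis by (simp add: e_def wt_def)
  qed
  have supp: "v \<in> \<sigma>" if "f \<in> geom_simplex \<sigma>" "f v \<noteq> 0" for f v \<sigma>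
    using that by (auto simp: geom_simplex_def)
  \<comment> \<open>On a simplex that misses \<open>U\<close> or \<open>W\<close> the function is
    constantly 1. One that meets both lies in \<open>U \<union> W\<close> by \<open>cut\<close>, and
    the exponential formula holds on all of it: where the weight on \<open>U\<close> vanishes, the
    weight on \<open>W\<close> is 1 and the exponential is 1 as well.\<close>
  have cont: "continuous_on (geom_simplex \<sigma>) e" if \<sigma>: "poset_chain V rel \<sigma>" for \<sigma>
  proof (cases "\<sigma> \<inter> U = {} \<or> \<sigma> \<inter> W = {}")
    case True
    have "e f = 1" if f: "f \<in> geom_simplex \<sigma>" for f
      using True supp[OF f] by (metis IntI e_noU e_noW empty_iff)
    then show ?thesis by (metis (no_types, lifting) continuous_on_cong continuous_on_const)
  next
    case False
    then obtain x y where xy: "x \<in> \<sigma>" "x \<in> U" "y \<in> \<sigma>" "y \<in> W" by auto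
    have sub: "\<sigma> \<subseteq> U \<union> W"
    proof
      fix z assume "z \<in> \<sigma>"
      then have "poset_chain V rel {x, y, z}" using xy by (intro chain_subset[OF \<sigma>]) auto
      then show "z \<in> U \<union> W" using cut xy by blast
    qed
    have fin: "finite \<sigma>" using \<sigma> by (rule chain_finite)
    have eq: "e f = exp (2 * pi * \<i> * of_real (\<Sum>v\<in>\<sigma> \<inter> W. f v))" if f: "f \<in> geom_simplex \<sigma>" for f
    proof -
      have w: "wt f = (\<Sum>v\<in>\<sigma> \<inter> W. f v)"
        unfolding wt_def using supp[OF f] fin by (intro sum.mono_neutral_left) auto
      show ?thesis
      proof (cases "\<exists>v\<in>U. f v \<noteq> 0")
        case True
        then show ?thesis by (simp add: e_def w)
      next
        case False
        have "sum f (\<sigma> \<inter> W) = sum f \<sigma>"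
          using False sub fin by (intro sum.mono_neutral_left) auto
        also have "\<dots> = 1" using f by (simp add: geom_simplex_def)
        finally have "exp (2 * pi * \<i> * of_real (\<Sum>v\<in>\<sigma> \<inter> W. f v)) = 1" by simp
        then show ?thesis using False by (simp add: e_def)
      qed
    qed
    have "continuous_on (geom_simplex \<sigma>) (\<lambda>f::'v\<Rightarrow>real. f v)" for v
      by (rule continuous_on_subset[OF continuous_on_product_coordinates]) auto
    then have "continuous_on (geom_simplex \<sigma>) (\<lambda>f::'v\<Rightarrow>real. exp (2 * pi * \<i> * of_real (\<Sum>v\<in>\<sigma> \<inter> W. f v)))"
      by (intro continuous_intros)
    then show ?thesis by (rule continuous_on_eq) (simp add: eq)
  qed
  have e_cont: "continuous_map realization (top_of_set (- {0})) e"
    unfolding continuous_map_in_subtopology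
  proof
    show "e \<in> topspace realization \<rightarrow> - {0}" by (auto simp: e_def)
    show "continuous_map realization euclidean e"
      unfolding continuous_map
    proof (intro conjI allI impI)
      fix O' :: "complex set" assume O': "openin euclidean O'"
      have "openin (top_of_set (geom_simplex \<sigma>)) ({f \<in> realization_carrier V rel. e f \<in> O'} \<inter> geom_simplex \<sigma>)"
        if \<sigma>: "poset_chain V rel \<sigma>" for \<sigma>
      proof -
        have "{f \<in> realization_carrier V rel. e f \<in> O'} \<inter> geom_simplex \<sigma> = geom_simplex \<sigma> \<inter> e -` O'"
          using simplex_subset_carrier[OF \<sigma>] by auto
        then show ?thesis using cont[OF \<sigma>] O' by (simp add: continuous_openin_preimage_gen)
      qed
      then show "openin realization {f \<in> topspace realization. e f \<in> O'}"
        by (auto simp: openin_realization realization_open_iff)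
    qed auto
  qed
  define u where "u = last l"
  define w where "w = hd l"
  have uw: "u \<in> U" "w \<in> W" "u \<notin> W" "w \<notin> U" "u \<noteq> w" using l disj by (auto simp: u_def w_def)
  have "l \<noteq> []" using l(1) by auto
  \<comment> \<open>The closing edge from \<open>last l\<close> to \<open>hd l\<close> is the only
    one that passes between \<open>U\<close> and \<open>W\<close>; it will contribute winding number
    1 and the rest of the loop nothing.\<close>
  define g where "g = segment (vertex u) (vertex w) +++ polygon l"
  have gg: "fin_homotopic g g"
    unfolding g_def using l \<open>l \<noteq> []\<close>
    by (intro fin_homotopic_join fin_homotopic_polygon fin_homotopic_segment[of "{u, w}"] vertex_in_simplex) (auto simp: u_def w_def)
  have g01: "g 0 = vertex u" "g 1 = vertex u"
    using fin_homotopic_imp_start[OF gg] pathfinish_polygon[OF \<open>l \<noteq> []\<close>]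
    by (auto simp: g_def joinpaths_def pathfinish_def u_def)
  have "pathin realization g"
  proof -
    obtain F where F: "finite F" "continuous_on {0..1} g" "g ` {0..1} \<subseteq> subcomplex F"
      using gg by (auto simp: fin_homotopic_refl path_def path_image_def)
    then show ?thesis
      unfolding pathin_def by (intro continuous_map_into_realization[of _ _ F]) auto
  qed
  then have "homotopic_with (\<lambda>h. h 0 = vertex u \<and> h 1 = vertex u) (top_of_set {0..1}) realization g (\<lambda>t. vertex u)"
    using sc g01 by (auto simp: simply_connected_space_def dest!: conjunct2 spec[of _ g])
  then have "homotopic_with (\<lambda>h. h 0 = e (vertex u) \<and> h 1 = e (vertex u)) (top_of_set {0..1}) (top_of_set (- {0}))
      (e \<circ> g) (e \<circ> (\<lambda>t. vertex u))"
    by (rule homotopic_with_compose_continuous_map_left[OF _ e_cont]) auto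
  moreover have e_vertex: "e (vertex v) = 1" for v
  proof (cases "v \<in> U")
    case True
    then show ?thesis using disj by (intro e_noW) (auto simp: vertex_def)
  next
    case False
    then show ?thesis by (intro e_noU) (auto simp: vertex_def)
  qed
  ultimately have hom: "homotopic_paths (- {0}) (e \<circ> g) (\<lambda>_. 1)"
    using g01 unfolding homotopic_paths_def by (simp add: pathstart_def pathfinish_def o_def)
  \<comment> \<open>Such an edge avoids \<open>W\<close> if it touches \<open>U\<close>, so in every
    case it misses one of the two sets.\<close>
  have e_edge: "e (segment (vertex x) (vertex y) t) = 1" if "\<not> (x \<in> U \<and> y \<in> W) \<and> \<not> (x \<in> W \<and> y \<in> U)" for x y t
  proof (cases "x \<in> U \<or> y \<in> U")
    case True
    then show ?thesis using that disj by (intro e_noW) (auto simp: segment_def vertex_def)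
  next
    case False
    then show ?thesis by (intro e_noU) (auto simp: segment_def vertex_def)
  qed
  have "successively (\<lambda>u v. \<forall>t. e (segment (vertex u) (vertex v) t) = 1) l"
    by (rule successively_mono[OF no_cross], intro allI e_edge, assumption)
  then have e_l: "e (polygon l t) = 1" for t
    by (rule polygon_eq_one[of e, OF e_vertex \<open>l \<noteq> []\<close>])
  \<comment> \<open>The point at parameter \<open>t\<close> has weight \<open>t\<close> on
    \<open>W\<close>. At \<open>t = 1\<close> there is no weight left on \<open>U\<close>, and the
    default value 1 closes the circle.\<close>
  have e_segment: "e (segment (vertex u) (vertex w) t) = circlepath 0 1 t" for t
  proof -
    have c: "circlepath 0 1 t = exp (2 * pi * \<i> * of_real t)"
      by (simp add: circlepath_def part_circlepath_def linepath_def scaleR_conv_of_real mult_ac)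
    show ?thesis
    proof (cases "t = 1")
      case True
      then show ?thesis using e_vertex[of w] c by simp
    next
      case False
      have "\<exists>v\<in>U. segment (vertex u) (vertex w) t v \<noteq> 0"
        using False uw by (intro bexI[of _ u]) (auto simp: segment_def vertex_def)
      moreover have "wt (segment (vertex u) (vertex w) t) = (\<Sum>v\<in>{w}. segment (vertex u) (vertex w) t v)"
        unfolding wt_def using uw by (intro sum.mono_neutral_left) (auto simp: segment_def vertex_def)
      moreover have "segment (vertex u) (vertex w) t w = t" using uw by (simp add: segment_def vertex_def)
      ultimately show ?thesis by (simp add: e_def c)
    qed
  qed
  have "e \<circ> g = circlepath 0 1 +++ (\<lambda>_. 1)"
    by (auto simp: g_def joinpaths_def e_l e_segment)
  then have "winding_number (circlepath 0 1 +++ (\<lambda>_. 1)) 0 = winding_number (\<lambda>_. 1) 0"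
    using winding_number_homotopic_paths[OF hom] by simp
  moreover have "winding_number (circlepath 0 1 +++ (\<lambda>_. 1)) 0 = winding_number (circlepath 0 1) 0 + winding_number (\<lambda>_. 1) 0"
  proof (rule winding_number_join)
    show "pathfinish (circlepath 0 1) = pathstart (\<lambda>_. 1 :: complex)"
      by (simp add: pathstart_def)
    show "path (\<lambda>_. 1 :: complex)" "0 \<notin> path_image (\<lambda>_. 1 :: complex)"
      by (simp_all add: path_def path_image_def)
  qed auto
  ultimately show False
    by (simp add: winding_number_circlepath_centre)
qed

end

section \<open>Coset posets\<close>

context group
begin

lemma inv_mult_cancel [simp]:
  assumes "x \<in> carrier G" "y \<in> carrier G"
  shows "inv x \<otimes> (x \<otimes> y) = y" "x \<otimes> (inv x \<otimes> y) = y"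
  using assms by (simp_all add: m_assoc[symmetric])

text \<open>Closure under a b^-1 c describes cosets without a base point, hence it passes directly
  to images and preimages under homomorphisms. Conversely, for any \<open>x\<close> in a nonempty
  closed set \<open>C\<close>, the translate x^-1 C is a subgroup with coset
  \<open>C\<close>.\<close>

lemma coset_poset_iff_heap:
  "C \<in> coset_poset G \<longleftrightarrow> C \<subseteq> carrier G \<and> C \<noteq> {} \<and> C \<noteq> carrier G \<and>
     (\<forall>a\<in>C. \<forall>b\<in>C. \<forall>c\<in>C. a \<otimes> inv b \<otimes> c \<in> C)"
proof
  assume "C \<in> coset_poset G"
  then obtain x S where C: "C = x <# S" and x: "x \<in> carrier G" and S: "subgroup S G" "S \<noteq> carrier G"
    by (auto simp: coset_poset_def)
  have sub: "C \<subseteq> carrier G" using C x S(1) by (simp add: l_coset_subset_G subgroup.subset)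
  moreover have "C \<noteq> {}" using C S(1) subgroup.one_closed[OF S(1)] by (auto simp: l_coset_def)
  moreover have "C \<noteq> carrier G"
  proof
    assume *: "C = carrier G"
    have "y \<in> S" if y: "y \<in> carrier G" for y
    proof -
      have "x \<otimes> y \<in> x <# S" using * x y C by auto
      then obtain s where s: "s \<in> S" "x \<otimes> y = x \<otimes> s" by (auto simp: l_coset_def)
      then have "y = s" using x y subgroup.mem_carrier[OF S(1)] by simp
      then show ?thesis using s by simp
    qed
    then show False using S subgroup.subset[OF S(1)] by blast
  qed
  moreover have "a \<otimes> inv b \<otimes> c \<in> C" if abc: "a \<in> C" "b \<in> C" "c \<in> C" for a b c
  proof -
    obtain s t r where *: "s \<in> S" "t \<in> S" "r \<in> S" "a = x \<otimes> s" "b = x \<otimes> t" "c = x \<otimes> r"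
      using abc C by (auto simp: l_coset_def)
    have car: "s \<in> carrier G" "t \<in> carrier G" "r \<in> carrier G"
      using * subgroup.mem_carrier[OF S(1)] by auto
    have "a \<otimes> inv b \<otimes> c = x \<otimes> (s \<otimes> inv t \<otimes> r)"
      using * car x by (simp add: inv_mult_group m_assoc)
    moreover have "s \<otimes> inv t \<otimes> r \<in> S"
      using * S(1) by (simp add: subgroup.m_closed subgroup.m_inv_closed)
    ultimately show ?thesis using C by (auto simp: l_coset_def)
  qed
  ultimately show "C \<subseteq> carrier G \<and> C \<noteq> {} \<and> C \<noteq> carrier G \<and>
     (\<forall>a\<in>C. \<forall>b\<in>C. \<forall>c\<in>C. a \<otimes> inv b \<otimes> c \<in> C)" by blast
next
  assume C: "C \<subseteq> carrier G \<and> C \<noteq> {} \<and> C \<noteq> carrier G \<and>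
     (\<forall>a\<in>C. \<forall>b\<in>C. \<forall>c\<in>C. a \<otimes> inv b \<otimes> c \<in> C)"
  then obtain x where x: "x \<in> C" "x \<in> carrier G" by auto
  define S where "S = {s \<in> carrier G. x \<otimes> s \<in> C}"
  have S: "subgroup S G"
  proof (rule subgroupI)
    show "S \<subseteq> carrier G" "S \<noteq> {}" using x by (auto simp: S_def)
    show "inv a \<in> S" if "a \<in> S" for a
    proof -
      have a: "a \<in> carrier G" "x \<otimes> a \<in> C" using that by (auto simp: S_def)
      then have "x \<otimes> inv (x \<otimes> a) \<otimes> x \<in> C" using C x by blast
      moreover have "x \<otimes> inv (x \<otimes> a) \<otimes> x = x \<otimes> inv a"
        using a x by (simp add: inv_mult_group m_assoc)
      ultimately show ?thesis using a by (simp add: S_def)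
    qed
    show "a \<otimes> b \<in> S" if "a \<in> S" "b \<in> S" for a b
    proof -
      have ab: "a \<in> carrier G" "x \<otimes> a \<in> C" "b \<in> carrier G" "x \<otimes> b \<in> C" using that by (auto simp: S_def)
      then have "(x \<otimes> a) \<otimes> inv x \<otimes> (x \<otimes> b) \<in> C" using C x by blast
      moreover have "(x \<otimes> a) \<otimes> inv x \<otimes> (x \<otimes> b) = x \<otimes> (a \<otimes> b)"
        using ab x by (simp add: m_assoc)
      ultimately show ?thesis using ab by (simp add: S_def)
    qed
  qed
  have eq: "C = x <# S"
  proof
    show "C \<subseteq> x <# S"
    proof
      fix y assume y: "y \<in> C"
      then have "y \<in> carrier G" using C by blast
      then have "y = x \<otimes> (inv x \<otimes> y)" "inv x \<otimes> y \<in> S" using x y by (simp_all add: S_def)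
      then show "y \<in> x <# S" unfolding l_coset_def by blast
    qed
    show "x <# S \<subseteq> C" by (auto simp: l_coset_def S_def)
  qed
  have "x <# carrier G = carrier G" using x by (simp add: coset_join3 subgroup_self)
  then have "S \<noteq> carrier G" using eq C by metis
  then show "C \<in> coset_poset G" using eq S x by (auto simp: coset_poset_def)
qed

lemma coset_posetI:
  assumes "C \<subseteq> carrier G" "x \<in> C" "y \<in> carrier G" "y \<notin> C"
    and "\<And>a b c. a \<in> C \<Longrightarrow> b \<in> C \<Longrightarrow> c \<in> C \<Longrightarrow> a \<otimes> inv b \<otimes> c \<in> C"
  shows "C \<in> coset_poset G"
  unfolding coset_poset_iff_heap using assms by blast

lemma coset_poset_heap:
  assumes "C \<in> coset_poset G" "a \<in> C" "b \<in> C" "c \<in> C"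
  shows "a \<otimes> inv b \<otimes> c \<in> C"
  using assms by (simp add: coset_poset_iff_heap)

lemma coset_poset_carrier: "C \<in> coset_poset G \<Longrightarrow> x \<in> C \<Longrightarrow> x \<in> carrier G"
  by (auto simp: coset_poset_iff_heap)

text \<open>With g = x^-1 y, exponents are raised by applying the ternary operation with x, y on the
  right, and lowered with y, x.\<close>

lemma coset_poset_int_pow:
  assumes C: "C \<in> coset_poset G" and xy: "x \<in> C" "y \<in> C"
  shows "x \<otimes> (inv x \<otimes> y) [^] (n::int) \<in> C"
proof -
  have car: "x \<in> carrier G" "y \<in> carrier G" using assms by (auto dest: coset_poset_carrier)
  define g where "g = inv x \<otimes> y"
  have g: "g \<in> carrier G" "x \<otimes> g = y" using car by (simp_all add: g_def)
  have up: "x \<otimes> g [^] (n + 1) \<in> C" if "x \<otimes> g [^] n \<in> C" for n :: int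
  proof -
    have "(x \<otimes> g [^] n) \<otimes> inv x \<otimes> y = x \<otimes> g [^] (n + 1)"
      using car g by (simp add: m_assoc int_pow_mult g_def)
    then show ?thesis using coset_poset_heap[OF C that xy] by simp
  qed
  have down: "x \<otimes> g [^] (n - 1) \<in> C" if "x \<otimes> g [^] n \<in> C" for n :: int
  proof -
    have "(x \<otimes> g [^] n) \<otimes> inv y \<otimes> x = x \<otimes> (g [^] n \<otimes> inv g)"
      using car by (simp add: m_assoc inv_mult_group g_def)
    also have "g [^] n \<otimes> inv g = g [^] (n - 1)"
      using g by (simp add: int_pow_diff)
    finally show ?thesis using coset_poset_heap[OF C that xy(2,1)] by simp
  qed
  have "x \<otimes> g [^] n \<in> C"
    by (induction n rule: int_induct[where k = 0]) (use xy car up down in auto)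
  then show ?thesis by (simp add: g_def)
qed

text \<open>The list d x is {x}, the fibre of x, {alpha x}, B.  For C with proper image, both
  {x} # C # d y and d x are homotopic to [{x}, R C, alpha ` C, B], which does not involve y.\<close>

theorem simply_connected_coset_poset:
  assumes hom: "\<alpha> \<in> hom G G" and idem: "\<And>x. x \<in> carrier G \<Longrightarrow> \<alpha> (\<alpha> x) = \<alpha> x"
    and not_onto: "\<alpha> ` carrier G \<noteq> carrier G"
    and split: "\<And>g. g \<in> carrier G \<Longrightarrow> \<exists>i j::int. i + j = 1 \<and>
      range (\<lambda>k::int. \<alpha> (g [^] (i * k))) \<noteq> \<alpha> ` carrier G \<and>
      range (\<lambda>k::int. \<alpha> (g [^] (j * k))) \<noteq> \<alpha> ` carrier G"
  shows "simply_connected_space (order_complex_realization (coset_poset G) (\<subseteq>))"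
proof -
  interpret vertex_relation "coset_poset G" "(\<subseteq>)" .
  interpret group_hom G G \<alpha> by (simp add: group_hom_def group_hom_axioms_def hom is_group)
  let ?V = "coset_poset G"
  define B where "B = \<alpha> ` carrier G"
  \<comment> \<open>\<open>fib x\<close> is a coset of the kernel. \<open>R C\<close> is the
    preimage of the image of \<open>C\<close>; it is proper as soon as that image is smaller than
    \<open>B\<close>.\<close>
  define fib where "fib = (\<lambda>x. {y \<in> carrier G. \<alpha> y = \<alpha> x})"
  define R where "R = (\<lambda>C. {y \<in> carrier G. \<alpha> y \<in> \<alpha> ` C})"
  define d where "d = (\<lambda>x. [{x}, fib x, {\<alpha> x}, B])"
  have heap_hom: "\<alpha> (a \<otimes> inv b \<otimes> c) = \<alpha> a \<otimes> inv (\<alpha> b) \<otimes> \<alpha> c"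
    if "a \<in> carrier G" "b \<in> carrier G" "c \<in> carrier G" for a b c
    using that by simp
  obtain w where w: "w \<in> carrier G" "w \<notin> B" using not_onto by (auto simp: B_def)
  obtain z where z: "z \<in> carrier G" "\<alpha> z \<noteq> \<one>"
  proof -
    \<comment> \<open>Splitting the neutral element shows that the image of \<open>\<alpha>\<close>
      is not trivial. The witness \<open>z\<close> outside the kernel then makes points and fibres
      proper, as \<open>w\<close> does for images.\<close>
    obtain i :: int where "range (\<lambda>k::int. \<alpha> (\<one> [^] (i * k))) \<noteq> \<alpha> ` carrier G" using split[of \<one>] by auto
    then have "\<alpha> ` carrier G \<noteq> {\<one>}" by auto
    moreover have "\<one> \<in> \<alpha> ` carrier G" by (metis hom_one imageI one_closed)
    ultimately show thesis using that by blast
  qed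

  \<comment> \<open>Cosets on which the contracting paths run\<close>
  have pt: "{x} \<in> ?V" if "x \<in> carrier G" for x
  proof -
    obtain y where "y \<in> carrier G" "y \<noteq> x" using z by (metis hom_one one_closed)
    then show ?thesis using that by (intro coset_posetI[of "{x}" x y]) (auto simp: m_assoc)
  qed
  have fib: "fib x \<in> ?V" if x: "x \<in> carrier G" for x
  proof -
    obtain y where "y \<in> carrier G" "\<alpha> y \<noteq> \<alpha> x" using z by (metis hom_one one_closed)
    then show ?thesis
      using x by (intro coset_posetI[of "fib x" x y]) (auto simp: fib_def m_assoc)
  qed
  have image: "\<alpha> ` C \<in> ?V" if C: "C \<subseteq> carrier G" "C \<noteq> {}"
    "\<And>a b c. a \<in> C \<Longrightarrow> b \<in> C \<Longrightarrow> c \<in> C \<Longrightarrow> a \<otimes> inv b \<otimes> c \<in> C" for C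
  proof -
    obtain x where "x \<in> C" using C(2) by auto
    then show ?thesis
    proof (intro coset_posetI[of _ "\<alpha> x" w])
      show "w \<notin> \<alpha> ` C" using w C(1) by (auto simp: B_def)
      fix a b c assume "a \<in> \<alpha> ` C" "b \<in> \<alpha> ` C" "c \<in> \<alpha> ` C"
      then obtain a' b' c' where *: "a' \<in> C" "b' \<in> C" "c' \<in> C" "a = \<alpha> a'" "b = \<alpha> b'" "c = \<alpha> c'" by auto
      then have "a \<otimes> inv b \<otimes> c = \<alpha> (a' \<otimes> inv b' \<otimes> c')" using C(1) by (subst heap_hom) auto
      then show "a \<otimes> inv b \<otimes> c \<in> \<alpha> ` C" using C(3) * by auto
    qed (use C(1) w in auto)
  qed
  have B: "B \<in> ?V" unfolding B_def by (rule image) auto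
  have A: "\<alpha> ` C \<in> ?V" if C: "C \<in> ?V" for C
    using C by (intro image) (auto simp: coset_poset_iff_heap)
  have R: "R C \<in> ?V" if C: "C \<in> ?V" "\<alpha> ` C \<noteq> B" for C
  proof -
    obtain x where x: "x \<in> C" "x \<in> carrier G" using C(1) by (auto simp: coset_poset_iff_heap)
    have "\<alpha> ` C \<subseteq> B" using C(1) by (auto simp: coset_poset_iff_heap B_def)
    then obtain y where y: "y \<in> carrier G" "\<alpha> y \<notin> \<alpha> ` C" using C(2) by (auto simp: B_def)
    show ?thesis
    proof (rule coset_posetI[of _ x y])
      fix a b c assume abc: "a \<in> R C" "b \<in> R C" "c \<in> R C"
      then have "a \<otimes> inv b \<otimes> c \<in> carrier G" "\<alpha> (a \<otimes> inv b \<otimes> c) = \<alpha> a \<otimes> inv (\<alpha> b) \<otimes> \<alpha> c"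
        by (auto simp: R_def)
      moreover have "\<alpha> a \<otimes> inv (\<alpha> b) \<otimes> \<alpha> c \<in> \<alpha> ` C"
        using abc by (intro coset_poset_heap[OF A[OF C(1)]]) (auto simp: R_def)
      ultimately show "a \<otimes> inv b \<otimes> c \<in> R C" by (simp add: R_def)
    qed (use x y in \<open>auto simp: R_def\<close>)
  qed
  have C_sub: "C \<subseteq> carrier G" if "C \<in> ?V" for C using that by (simp add: coset_poset_iff_heap)
  have C_R: "C \<subseteq> R C" if "C \<in> ?V" for C using C_sub[OF that] by (auto simp: R_def)
  have fib_R: "fib x \<subseteq> R C" if "x \<in> C" for x C using that by (auto simp: fib_def R_def)
  have A_R: "\<alpha> ` C \<subseteq> R C" if "C \<in> ?V" for C using C_sub[OF that] idem by (auto simp: R_def)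
  have A_B: "\<alpha> ` C \<subseteq> B" if "C \<in> ?V" for C using C_sub[OF that] by (auto simp: B_def)
  have x_fib: "x \<in> fib x" "\<alpha> x \<in> fib x" "\<alpha> x \<in> B" if "x \<in> carrier G" for x
    using that idem by (auto simp: fib_def B_def)
  note chain = poset_chain_def

  \<comment> \<open>The contracting paths and their independence of choices\<close>
  have d: "edge_path (d x)" if "x \<in> carrier G" for x
    using that x_fib[OF that] by (simp add: d_def chain pt fib B)
  \<comment> \<open>By idempotence \<open>R C\<close> contains \<open>\<alpha>\<close>
    C\<open>, and it also contains\<close>fib x\<open>. Passing through\<close>\<alpha>
    \<open>C\<close> instead of \<open>{\<alpha> x}\<close> removes the dependence on
    \<open>x\<close>.\<close>
  have tail: "edge_homotopic [R C, fib x, {\<alpha> x}, B] [R C, \<alpha> ` C, B]"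
    if C: "C \<in> ?V" "\<alpha> ` C \<noteq> B" and x: "x \<in> C" for C x
  proof -
    have xG: "x \<in> carrier G" using C x by (auto dest: C_sub)
    note mem = pt[OF xG] pt[OF hom_closed[OF xG]] fib[OF xG] A[OF C(1)] B R[OF C] x_fib[OF xG]
      C_R[OF C(1)] fib_R[OF x] A_R[OF C(1)] A_B[OF C(1)]
    have ax: "\<alpha> x \<in> R C" "\<alpha> x \<in> \<alpha> ` C" using x A_R[OF C(1)] by auto
    have "edge_homotopic [R C, fib x, {\<alpha> x}, B] [R C, {\<alpha> x}, B]"
      using mem ax by (intro edge_homotopic_triangle) (auto simp: chain)
    also have "edge_homotopic [R C, {\<alpha> x}, B] [R C, {\<alpha> x}, \<alpha> ` C, B]"
      using mem ax by (intro edge_homotopic_Cons edge_homotopic_sym[OF edge_homotopic_triangle]) (auto simp: chain)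
    also have "edge_homotopic [R C, {\<alpha> x}, \<alpha> ` C, B] [R C, \<alpha> ` C, B]"
      using mem ax by (intro edge_homotopic_triangle) (auto simp: chain)
    finally show ?thesis .
  qed
  have single: "edge_homotopic ({x} # C # d y) (d x)"
    if C: "C \<in> ?V" "\<alpha> ` C \<noteq> B" and xy: "x \<in> C" "y \<in> C" for C x y
  proof -
    have xG: "x \<in> carrier G" and yG: "y \<in> carrier G" using C xy by (auto dest: C_sub)
    note mem = pt[OF xG] pt[OF yG] fib[OF xG] fib[OF yG] A[OF C(1)] B R[OF C] x_fib[OF xG] x_fib[OF yG]
      C_R[OF C(1)] fib_R[OF xy(1)] fib_R[OF xy(2)] pt[OF hom_closed[OF xG]] pt[OF hom_closed[OF yG]] C(1)
    have R_mem: "x \<in> R C" "y \<in> R C" using C_R[OF C(1)] xy by auto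
    have e: "edge_path [{y}, fib y, {\<alpha> y}, B]" using d[OF yG] by (simp add: d_def)
    have "edge_homotopic ({x} # C # d y) ({x} # C # R C # d y)"
      unfolding d_def using mem xy R_mem e
      by (intro edge_homotopic_Cons edge_homotopic_sym[OF edge_homotopic_triangle]) (auto simp: chain)
    also have "edge_homotopic \<dots> ({x} # R C # d y)"
      unfolding d_def using mem xy R_mem e by (intro edge_homotopic_triangle) (auto simp: chain)
    also have "edge_homotopic \<dots> [{x}, R C, fib y, {\<alpha> y}, B]"
      unfolding d_def using mem xy R_mem e by (intro edge_homotopic_Cons edge_homotopic_triangle) (auto simp: chain)
    also have "edge_homotopic \<dots> [{x}, R C, \<alpha> ` C, B]"
      using mem R_mem by (intro edge_homotopic_Cons tail C xy) (auto simp: chain)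
    also have "edge_homotopic \<dots> [{x}, R C, fib x, {\<alpha> x}, B]"
      using mem R_mem by (intro edge_homotopic_Cons edge_homotopic_sym[OF tail] C xy) (auto simp: chain)
    also have "edge_homotopic \<dots> (d x)"
      unfolding d_def using mem xy R_mem by (intro edge_homotopic_triangle) (auto simp: chain)
    finally show ?thesis .
  qed
  \<comment> \<open>With g = x^-1 y the step from x to y is divided at v = x g^i, as g^i g^j = g.
    The cosets x<g^i> and v<g^j> lie in \<open>C\<close> and have proper images, so
    \<open>single\<close> applies to each half.\<close>
  have full: "edge_homotopic ({x} # C # d y) (d x)" if C: "C \<in> ?V" and xy: "x \<in> C" "y \<in> C" for C x y
  proof -
    have xG: "x \<in> carrier G" and yG: "y \<in> carrier G" using C xy by (auto dest: C_sub)
    define g where "g = inv x \<otimes> y"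
    have g: "g \<in> carrier G" "x \<otimes> g = y" using xG yG by (simp_all add: g_def)
    obtain i j :: int where ij: "i + j = 1"
      "range (\<lambda>k::int. \<alpha> (g [^] (i * k))) \<noteq> \<alpha> ` carrier G"
      "range (\<lambda>k::int. \<alpha> (g [^] (j * k))) \<noteq> \<alpha> ` carrier G"
      using split[OF g(1)] by (elim exE conjE) (rule that)
    have in_C: "x \<otimes> g [^] n \<in> C" for n :: int
      using coset_poset_int_pow[OF C xy] by (simp add: g_def)
    \<comment> \<open>The coset u<g^n>. Its image is proper because \<open>\<alpha>\<close> maps
      some \<open>s\<close> outside the image of <g^n>, and then \<open>u \<otimes> s\<close>
      witnesses that the coset and its image are proper.\<close>
    define D where "D = (\<lambda>u n. range (\<lambda>k::int. u \<otimes> g [^] (n * k)))"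
    have D_V: "D u n \<in> ?V" and D_A: "\<alpha> ` D u n \<noteq> B"
      if u: "u \<in> carrier G" and n: "range (\<lambda>k::int. \<alpha> (g [^] (n * k))) \<noteq> \<alpha> ` carrier G" for u n
    proof -
      have "range (\<lambda>k::int. \<alpha> (g [^] (n * k))) \<subseteq> \<alpha> ` carrier G" using g by auto
      then obtain s where s: "s \<in> carrier G" "\<alpha> s \<notin> range (\<lambda>k::int. \<alpha> (g [^] (n * k)))"
        using n by auto
      have "\<alpha> (u \<otimes> s) \<notin> \<alpha> ` D u n"
        using s u g by (auto simp: D_def)
      moreover have us: "u \<otimes> s \<in> carrier G" using s u by simp
      ultimately show "\<alpha> ` D u n \<noteq> B" by (auto simp: B_def)
      show "D u n \<in> ?V"
      proof (rule coset_posetI[of _ "u \<otimes> g [^] (n * 0)" "u \<otimes> s"])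
        show "u \<otimes> s \<notin> D u n" using \<open>\<alpha> (u \<otimes> s) \<notin> \<alpha> ` D u n\<close> by blast
        show "u \<otimes> g [^] (n * 0) \<in> D u n" unfolding D_def by blast
        fix a b c assume "a \<in> D u n" "b \<in> D u n" "c \<in> D u n"
        then obtain a' b' c' :: int where *: "a = u \<otimes> g [^] (n * a')" "b = u \<otimes> g [^] (n * b')"
          "c = u \<otimes> g [^] (n * c')" by (auto simp: D_def)
        have "a \<otimes> inv b \<otimes> c = u \<otimes> ((g [^] (n * a') \<otimes> inv (g [^] (n * b'))) \<otimes> g [^] (n * c'))"
          using u g by (simp add: * m_assoc inv_mult_group)
        also have "\<dots> = u \<otimes> g [^] (n * (a' - b' + c'))"
          using g by (simp add: int_pow_diff[symmetric] int_pow_mult[symmetric] algebra_simps)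
        finally show "a \<otimes> inv b \<otimes> c \<in> D u n" unfolding D_def by blast
      qed (use u g us in \<open>auto simp: D_def\<close>)
    qed
    define v where "v = x \<otimes> g [^] i"
    have vC: "v \<in> C" unfolding v_def by (rule in_C)
    then have vG: "v \<in> carrier G" using C by (auto dest: C_sub)
    define D1 where "D1 = D x i"
    define D2 where "D2 = D v j"
    have D1: "D1 \<in> ?V" "\<alpha> ` D1 \<noteq> B" unfolding D1_def using D_V D_A xG ij by auto
    have D2: "D2 \<in> ?V" "\<alpha> ` D2 \<noteq> B" unfolding D2_def using D_V D_A vG ij by auto
    have "x \<otimes> g [^] (i * 0) = x" "x \<otimes> g [^] (i * 1) = v" "v \<otimes> g [^] (j * 0) = v"
      using xG vG by (simp_all add: v_def)
    moreover have "v \<otimes> g [^] (j * 1) = y"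
      using xG g ij(1) by (simp add: v_def m_assoc int_pow_mult[symmetric])
    ultimately have D_mem: "x \<in> D1" "v \<in> D1" "v \<in> D2" "y \<in> D2"
      unfolding D1_def D2_def D_def by (metis rangeI)+
    have "D1 \<subseteq> C" unfolding D1_def D_def using in_C by auto
    have "D2 \<subseteq> C"
    proof -
      have "v \<otimes> g [^] (j * k) = x \<otimes> g [^] (i + j * k)" for k
        using xG g by (simp add: v_def m_assoc int_pow_mult)
      then show ?thesis unfolding D2_def D_def using in_C by auto
    qed
    note mem = pt[OF xG] pt[OF yG] pt[OF vG] C D1(1) D2(1) D_mem \<open>D1 \<subseteq> C\<close> \<open>D2 \<subseteq> C\<close> xy vC
    have e: "edge_path ({y} # tl (d y))" "d y = {y} # tl (d y)" "edge_path ({v} # tl (d v))" "d v = {v} # tl (d v)"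
      using d[OF yG] d[OF vG] by (simp_all add: d_def)
    have eC: "edge_path (C # {y} # tl (d y))" using e(1) mem by (auto simp: chain)
    have s2: "edge_homotopic ({v} # D2 # {y} # tl (d y)) ({v} # tl (d v))"
      using single[OF D2 D_mem(3,4)] by (simp only: e(2,4)[symmetric])
    have "edge_homotopic ({x} # C # {y} # tl (d y)) ({x} # D1 # C # {y} # tl (d y))"
      using mem eC by (intro edge_homotopic_sym[OF edge_homotopic_triangle]) (auto simp: chain)
    also have "edge_homotopic \<dots> ({x} # D1 # {v} # C # {y} # tl (d y))"
      using mem eC by (intro edge_homotopic_Cons edge_homotopic_sym[OF edge_homotopic_triangle]) (auto simp: chain)
    also have "edge_homotopic \<dots> ({x} # D1 # {v} # D2 # C # {y} # tl (d y))"
      using mem eC by (intro edge_homotopic_Cons edge_homotopic_sym[OF edge_homotopic_triangle]) (auto simp: chain)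
    also have "edge_homotopic \<dots> ({x} # D1 # {v} # D2 # {y} # tl (d y))"
      using mem e(1) by (intro edge_homotopic_Cons edge_homotopic_triangle) (auto simp: chain)
    also have "edge_homotopic \<dots> ({x} # D1 # {v} # tl (d v))"
      using mem by (intro edge_homotopic_Cons s2) (auto simp: chain)
    also have "edge_homotopic \<dots> (d x)" using single[OF D1 D_mem(1,2)] by (simp add: e(4)[symmetric])
    finally show ?thesis by (simp add: e(2)[symmetric])
  qed
  \<comment> \<open>The representative is arbitrary; \<open>c_any\<close> shows that any other point
    of \<open>C\<close> gives a homotopic path.\<close>
  define c where "c = (\<lambda>C. C # d (SOME x. x \<in> C))"
  have pick: "(SOME x. x \<in> C) \<in> C" if "C \<in> ?V" for C
    using that by (auto simp: coset_poset_iff_heap some_in_eq)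
  have c_any: "edge_homotopic (C # d x) (c C)" if C: "C \<in> ?V" and x: "x \<in> C" for C x
  proof -
    define p where "p = (SOME x. x \<in> C)"
    have p: "p \<in> C" unfolding p_def by (rule pick[OF C])
    have xG: "x \<in> carrier G" and pG: "p \<in> carrier G" using C x p by (auto dest: C_sub)
    note mem = pt[OF xG] pt[OF pG] C x p
    have e: "edge_path ({x} # tl (d x))" "d x = {x} # tl (d x)"
      using d[OF xG] by (simp_all add: d_def)
    have eC: "edge_path (C # {x} # tl (d x))" using e(1) mem by (auto simp: chain)
    have f: "edge_homotopic ({p} # C # {x} # tl (d x)) (d p)"
      using full[OF C p x] by (simp only: e(2)[symmetric])
    \<comment> \<open>Doubling \<open>C\<close> makes room to insert \<open>{p}\<close>, after which
      \<open>full\<close> replaces the path from \<open>p\<close> through \<open>x\<close>.\<close>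
    have "edge_homotopic (C # {x} # tl (d x)) (C # C # {x} # tl (d x))"
      using mem e(1) by (intro edge_homotopic_sym[OF edge_homotopic_triangle]) (auto simp: chain)
    also have "edge_homotopic \<dots> (C # {p} # C # {x} # tl (d x))"
      using mem eC by (intro edge_homotopic_sym[OF edge_homotopic_triangle]) (auto simp: chain)
    also have "edge_homotopic \<dots> (C # d p)"
      using mem by (intro edge_homotopic_Cons f) (auto simp: chain)
    finally show ?thesis unfolding c_def p_def by (simp add: e(2)[symmetric])
  qed
  show ?thesis
  proof (rule simply_connected_realization[of c B])
    fix C assume "poset_chain ?V (\<subseteq>) {C}"
    then have C: "C \<in> ?V" by (simp add: chain)
    show "edge_path (c C) \<and> hd (c C) = C \<and> last (c C) = B"
      using c_any[OF C pick[OF C]] by (auto simp: edge_homotopic_def c_def d_def)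
  next
    fix C C' assume CC: "poset_chain ?V (\<subseteq>) {C, C'}"
    then have V: "C \<in> ?V" "C' \<in> ?V" and cmp: "C \<subseteq> C' \<or> C' \<subseteq> C" by (auto simp: chain)
    \<comment> \<open>Comparable cosets share every point of the smaller one; both paths are
      compared through such a point.\<close>
    then obtain x where x: "x \<in> C" "x \<in> C'" using pick by blast
    have xG: "x \<in> carrier G" using V x by (auto dest: C_sub)
    have e: "edge_path ({x} # tl (d x))" "d x = {x} # tl (d x)"
      using d[OF xG] by (simp_all add: d_def)
    have "edge_homotopic (C # c C') (C # C' # d x)"
      using CC edge_homotopic_sym[OF c_any[OF V(2) x(2)]] by (intro edge_homotopic_Cons) (auto simp: c_def)
    also have "edge_homotopic (C # C' # {x} # tl (d x)) (C # {x} # tl (d x))"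
      using V x cmp e(1) pt[OF xG] by (intro edge_homotopic_triangle) (auto simp: chain)
    then have "edge_homotopic (C # C' # d x) (C # d x)" by (simp add: e(2)[symmetric])
    also have "edge_homotopic (C # d x) (c C)" by (rule c_any[OF V(1) x(1)])
    finally show "edge_homotopic (C # c C') (c C)" .
  qed
qed

end

section \<open>Direct products\<close>

text \<open>If \<open>h\<close> does not generate, the split 1 + 0 works. If it does, its order has
  two coprime divisors greater than 1, because the group is not of prime power order, and a Bezout
  relation between them gives \<open>i\<close> and \<open>j\<close>.\<close>

lemma (in group) exists_coprime_power_split:
  assumes ncpp: "\<not> cyclic_prime_power_group G" and nontriv: "carrier G \<noteq> {\<one>}" and h: "h \<in> carrier G"
  shows "\<exists>i j::int. i + j = 1 \<and> range (\<lambda>k::int. h [^] (i * k)) \<noteq> carrier G \<and>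
    range (\<lambda>k::int. h [^] (j * k)) \<noteq> carrier G"
proof (cases "range (\<lambda>k::int. h [^] k) = carrier G")
  case False
  then show ?thesis using nontriv by (intro exI[of _ 1] exI[of _ 0]) auto
next
  case True
  define n where "n = ord h"
  have cyc: "cyclic_group G" using True h by (auto simp: cyclic_group)
  have gen: "generate G {h} = carrier G" using True generate_pow[OF h] by auto
  have "\<exists>a b::nat. coprime a b \<and> a > 1 \<and> b > 1 \<and> a dvd n \<and> b dvd n"
  proof (cases "n = 0")
    case True
    \<comment> \<open>Here \<open>ord h = 0\<close> stands for infinite order; everything divides 0,
      so any coprime pair will do.\<close>
    then show ?thesis by (intro exI[of _ 2] exI[of _ 3]) simp
  next
    case False
    have card: "card (carrier G) = n" using generate_pow_card[OF h] gen by (simp add: n_def)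
    then have fin: "finite (carrier G)" using False card_ge_0_finite by auto
    have not_pp: "n \<noteq> p ^ k" if "Factorial_Ring.prime p" for p k :: nat
      using ncpp cyc fin card that by (auto simp: cyclic_prime_power_group_def)
    then have "n \<noteq> 1" using not_pp[of 2 0] by simp
    then obtain p :: nat where p: "Factorial_Ring.prime p" "p dvd n" using prime_factor_nat by blast
    obtain y where y: "n = p ^ multiplicity p n * y" "\<not> p dvd y"
      using False p(1) by (metis multiplicity_decompose' not_prime_unit)
    have "y \<noteq> 0" using y False by (intro notI) simp
    moreover have "y \<noteq> 1" using not_pp[OF p(1), of "multiplicity p n"] y(1) by (intro notI) simp
    moreover have "coprime p y" using p(1) y(2) by (rule prime_imp_coprime)
    moreover have "y dvd n" using y(1) by (metis dvd_triv_right)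
    ultimately show ?thesis using p prime_gt_1_nat by (intro exI[of _ p] exI[of _ y]) auto
  qed
  then obtain a b :: nat where ab: "coprime a b" "a > 1" "b > 1" "a dvd n" "b dvd n" by blast
  then have "coprime (int a) (int b)" by simp
  then obtain u v where uv: "u * int a + v * int b = 1" by (metis coprime_iff_gcd_eq_1 bezout_int)
  \<comment> \<open>If powers with exponents divisible by \<open>c\<close> reached \<open>h\<close>
    itself, some multiple of \<open>c\<close> would be 1 modulo \<open>n\<close>, hence modulo
    \<open>c\<close>.\<close>
  have proper: "range (\<lambda>k::int. h [^] (w * int c * k)) \<noteq> carrier G" if c: "c > 1" "c dvd n" for w c
  proof
    assume "range (\<lambda>k::int. h [^] (w * int c * k)) = carrier G"
    then obtain k :: int where "h = h [^] (w * int c * k)" using h by blast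
    then have "h [^] (1::int) = h [^] (w * int c * k)" using h by simp
    then have "int n dvd w * int c * k - 1" using int_pow_eq[OF h] by (simp add: n_def)
    then have "int c dvd w * int c * k - 1" using c(2) by (meson dvd_trans int_dvd_int_iff)
    then have "int c dvd 1" using dvd_diff[of "int c" "w * int c * k" "w * int c * k - 1"] by simp
    then show False using c(1) by simp
  qed
  show ?thesis
    using uv proper[OF ab(2,4), of u] proper[OF ab(3,5), of v] by blast
qed

text \<open>The idempotent endomorphism is the projection onto H x 1. It is not onto because K is
  nontrivial, and powers are split in the first component.\<close>

lemma simply_connected_coset_poset_DirProd_left:
  assumes "group H" "group K" "carrier H \<noteq> {\<one>\<^bsub>H\<^esub>}" "carrier K \<noteq> {\<one>\<^bsub>K\<^esub>}"
    and "\<not> cyclic_prime_power_group H"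
  shows "simply_connected_space (order_complex_realization (coset_poset (H \<times>\<times> K)) (\<subseteq>))"
proof -
  interpret H: group H by fact
  interpret K: group K by fact
  let ?G = "H \<times>\<times> K"
  interpret G: group ?G by (rule DirProd_group) fact+
  define \<alpha> where "\<alpha> = (\<lambda>x::'a \<times> 'c. (fst x, \<one>\<^bsub>K\<^esub>))"
  have pow: "fst (x [^]\<^bsub>?G\<^esub> n) = fst x [^]\<^bsub>H\<^esub> n" if "x \<in> carrier ?G" for x and n :: int
    using that by (intro hom_int_pow) (auto simp: hom_def)
  have img: "\<alpha> ` carrier ?G = carrier H \<times> {\<one>\<^bsub>K\<^esub>}"
    using K.one_closed by (force simp: \<alpha>_def image_iff)
  show ?thesis
  proof (rule G.simply_connected_coset_poset[of \<alpha>])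
    show "\<alpha> \<in> hom ?G ?G" by (auto simp: \<alpha>_def hom_def)
    show "\<alpha> (\<alpha> x) = \<alpha> x" for x by (simp add: \<alpha>_def)
    show "\<alpha> ` carrier ?G \<noteq> carrier ?G"
      unfolding img using assms(4) H.one_closed K.one_closed by (auto simp: times_eq_iff)
    fix g assume g: "g \<in> carrier ?G"
    then have "fst g \<in> carrier H" by auto
    from H.exists_coprime_power_split[OF assms(5,3) this] obtain i j :: int where ij: "i + j = 1"
      "range (\<lambda>k::int. fst g [^]\<^bsub>H\<^esub> (i * k)) \<noteq> carrier H"
      "range (\<lambda>k::int. fst g [^]\<^bsub>H\<^esub> (j * k)) \<noteq> carrier H" by (elim exE conjE) (rule that)
    have "range (\<lambda>k::int. \<alpha> (g [^]\<^bsub>?G\<^esub> (n * k))) = range (\<lambda>k::int. fst g [^]\<^bsub>H\<^esub> (n * k)) \<times> {\<one>\<^bsub>K\<^esub>}" for n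
      using pow[OF g] by (auto simp: \<alpha>_def)
    then show "\<exists>i j::int. i + j = 1 \<and>
        range (\<lambda>k::int. \<alpha> (g [^]\<^bsub>?G\<^esub> (i * k))) \<noteq> \<alpha> ` carrier ?G \<and>
        range (\<lambda>k::int. \<alpha> (g [^]\<^bsub>?G\<^esub> (j * k))) \<noteq> \<alpha> ` carrier ?G"
      using ij unfolding img by (intro exI[of _ i] exI[of _ j]) (auto simp: times_eq_iff)
  qed
qed

text \<open>The mirror image, with the projection onto 1 x K.\<close>

lemma simply_connected_coset_poset_DirProd_right:
  assumes "group H" "group K" "carrier H \<noteq> {\<one>\<^bsub>H\<^esub>}" "carrier K \<noteq> {\<one>\<^bsub>K\<^esub>}"
    and "\<not> cyclic_prime_power_group K"
  shows "simply_connected_space (order_complex_realization (coset_poset (H \<times>\<times> K)) (\<subseteq>))"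
proof -
  interpret H: group H by fact
  interpret K: group K by fact
  let ?G = "H \<times>\<times> K"
  interpret G: group ?G by (rule DirProd_group) fact+
  define \<alpha> where "\<alpha> = (\<lambda>x::'a \<times> 'c. (\<one>\<^bsub>H\<^esub>, snd x))"
  have pow: "snd (x [^]\<^bsub>?G\<^esub> n) = snd x [^]\<^bsub>K\<^esub> n" if "x \<in> carrier ?G" for x and n :: int
    using that by (intro hom_int_pow) (auto simp: hom_def)
  have img: "\<alpha> ` carrier ?G = {\<one>\<^bsub>H\<^esub>} \<times> carrier K"
    using H.one_closed by (force simp: \<alpha>_def image_iff)
  show ?thesis
  proof (rule G.simply_connected_coset_poset[of \<alpha>])
    show "\<alpha> \<in> hom ?G ?G" by (auto simp: \<alpha>_def hom_def)
    show "\<alpha> (\<alpha> x) = \<alpha> x" for x by (simp add: \<alpha>_def)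
    show "\<alpha> ` carrier ?G \<noteq> carrier ?G"
      unfolding img using assms(3) H.one_closed K.one_closed by (auto simp: times_eq_iff)
    fix g assume g: "g \<in> carrier ?G"
    then have "snd g \<in> carrier K" by auto
    from K.exists_coprime_power_split[OF assms(5,4) this] obtain i j :: int where ij: "i + j = 1"
      "range (\<lambda>k::int. snd g [^]\<^bsub>K\<^esub> (i * k)) \<noteq> carrier K"
      "range (\<lambda>k::int. snd g [^]\<^bsub>K\<^esub> (j * k)) \<noteq> carrier K" by (elim exE conjE) (rule that)
    have "range (\<lambda>k::int. \<alpha> (g [^]\<^bsub>?G\<^esub> (n * k))) = {\<one>\<^bsub>H\<^esub>} \<times> range (\<lambda>k::int. snd g [^]\<^bsub>K\<^esub> (n * k))" for n
      using pow[OF g] by (auto simp: \<alpha>_def)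
    then show "\<exists>i j::int. i + j = 1 \<and>
        range (\<lambda>k::int. \<alpha> (g [^]\<^bsub>?G\<^esub> (i * k))) \<noteq> \<alpha> ` carrier ?G \<and>
        range (\<lambda>k::int. \<alpha> (g [^]\<^bsub>?G\<^esub> (j * k))) \<noteq> \<alpha> ` carrier ?G"
      using ij unfolding img by (intro exI[of _ i] exI[of _ j]) (auto simp: times_eq_iff)
  qed
qed

text \<open>A Frattini argument in coordinates: \<open>1\<close> and \<open>2\<close> say that the
  lattice \<open>L\<close> maps onto Z/p x Z/q, and \<open>P\<close> and \<open>Q\<close> say that
  the quotient Z^2 / L is a quotient of Z/p^m x Z/q^n. Together they force \<open>L\<close> to be
  everything.\<close>

lemma lattice_eq_UNIV:
  fixes L :: "(int \<times> int) set"
  assumes lin: "\<And>s t x y x' y'. (x, y) \<in> L \<Longrightarrow> (x', y') \<in> L \<Longrightarrow> (s * x + t * x', s * y + t * y') \<in> L"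
    and p: "Factorial_Ring.prime p" and q: "Factorial_Ring.prime q"
    and P: "(p ^ m, 0) \<in> L" and Q: "(0, q ^ n) \<in> L"
    and 1: "(i, j) \<in> L" "\<not> p dvd i" "q dvd j"
    and 2: "(i', j') \<in> L" "\<not> q dvd j'"
  shows "L = UNIV"
proof -
  have "\<exists>D E. \<not> p dvd D \<and> (D, 0) \<in> L \<and> \<not> q dvd E \<and> (0, E) \<in> L"
  proof (cases "p = q")
    case True
    \<comment> \<open>The determinant of the two given vectors is nonzero modulo p; Cramer's rule
      puts its multiples of both unit vectors into \<open>L\<close>.\<close>
    define D where "D = i * j' - i' * j"
    have "\<not> p dvd i * j'" using p 1 2 True by (simp add: prime_dvd_mult_iff)
    moreover have "p dvd i' * j" using 1(3) True by simp
    ultimately have "\<not> p dvd D" unfolding D_def using dvd_diff_left_iff by blast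
    moreover have "(D, 0) \<in> L" using lin[OF 1(1) 2(1), of j' "- j"] by (simp add: D_def algebra_simps)
    moreover have "(0, D) \<in> L" using lin[OF 1(1) 2(1), of "- i'" i] by (simp add: D_def algebra_simps)
    ultimately show ?thesis using True by blast
  next
    case False
    \<comment> \<open>For distinct primes, multiplying by q^n lets \<open>Q\<close> clear the second
      coordinate without losing primality to p, and symmetrically with p^m.\<close>
    have "\<not> p dvd q" "\<not> q dvd p" using False p q by (auto dest: primes_dvd_imp_eq)
    then have "\<not> p dvd q ^ n * i" "\<not> q dvd p ^ m * j'"
      using p q 1 2 by (auto simp: prime_dvd_mult_iff dest: prime_dvd_power)
    moreover have "(q ^ n * i, 0) \<in> L" using lin[OF 1(1) Q, of "q ^ n" "- j"] by (simp add: algebra_simps)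
    moreover have "(0, p ^ m * j') \<in> L" using lin[OF 2(1) P, of "p ^ m" "- i'"] by (simp add: algebra_simps)
    ultimately show ?thesis by blast
  qed
  then obtain D E where DE: "\<not> p dvd D" "(D, 0) \<in> L" "\<not> q dvd E" "(0, E) \<in> L" by blast
  \<comment> \<open>An entry prime to p is combined with p^m to give 1, which yields the unit
    vectors.\<close>
  have bez: "\<exists>s t. s * D + t * p ^ m = 1" if "Factorial_Ring.prime p" "\<not> p dvd D" for p D :: int and m
  proof -
    have "coprime D (p ^ m)" using prime_imp_coprime[OF that] by (simp add: coprime_commute)
    then show ?thesis using bezout_int[of D "p ^ m"] by auto
  qed
  obtain s t where st: "s * D + t * p ^ m = 1" using bez[OF p DE(1)] by blast
  have e1: "(1, 0) \<in> L" using lin[OF DE(2) P, of s t] st by simp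
  obtain s t where st: "s * E + t * q ^ n = 1" using bez[OF q DE(3)] by blast
  have e2: "(0, 1) \<in> L" using lin[OF DE(4) Q, of s t] st by simp
  have "(x, y) \<in> L" for x y using lin[OF e1 e2, of x y] by simp
  then show ?thesis by auto
qed

text \<open>\<open>L\<close> is a chosen discrete logarithm to base \<open>a\<close>, unique only
  modulo the order of \<open>a\<close>. Nontriviality makes p divide that order, so logarithms are
  well defined modulo p.\<close>

lemma (in group) cyclic_prime_power_group_log:
  assumes cpp: "cyclic_prime_power_group G" and nontriv: "carrier G \<noteq> {\<one>}"
  obtains a and p :: int and m :: nat and L :: "'a \<Rightarrow> int"
  where "a \<in> carrier G" "Factorial_Ring.prime p" "carrier G = range (\<lambda>n::int. a [^] n)"
    "a [^] (p ^ m) = \<one>" "\<And>x. x \<in> carrier G \<Longrightarrow> a [^] L x = x" "\<And>i. p dvd L (a [^] i) - i"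
proof -
  obtain a where a: "a \<in> carrier G" "carrier G = range (\<lambda>n::int. a [^] n)"
    using cpp by (auto simp: cyclic_prime_power_group_def cyclic_group)
  obtain p :: nat and m where p: "Factorial_Ring.prime p" "card (carrier G) = p ^ m"
    using cpp by (auto simp: cyclic_prime_power_group_def)
  have "generate G {a} = carrier G" using generate_pow[OF a(1)] a(2) by auto
  then have ord: "ord a = p ^ m" using generate_pow_card[OF a(1)] p(2) by simp
  have "m \<noteq> 0"
  proof
    assume "m = 0"
    then have "ord a = 1" using ord by simp
    then have "a = \<one>" using a(1) ord_eq_1 by blast
    then show False using a(2) nontriv by auto
  qed
  then have "p dvd ord a" using ord by (simp add: dvd_power)
  define L where "L = (\<lambda>x. SOME i::int. a [^] i = x)"
  have L: "a [^] L x = x" if "x \<in> carrier G" for x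
    unfolding L_def by (rule someI_ex) (use that a(2) in auto)
  show thesis
  proof (rule that[of a "int p" m L])
    show "a [^] (int p ^ m) = \<one>"
      using int_pow_eq_id[OF a(1), of "int p ^ m"] ord by simp
    show "int p dvd L (a [^] i) - i" for i :: int
    proof -
      have "a [^] i = a [^] L (a [^] i)" using L[of "a [^] i"] a(1) by simp
      then have "int (ord a) dvd L (a [^] i) - i" using int_pow_eq[OF a(1)] by blast
      then show ?thesis using \<open>p dvd ord a\<close> by (meson dvd_trans int_dvd_int_iff)
    qed
  qed (use a p L in auto)
qed

text \<open>With N the group of pairs whose logarithms are divisible by p and q, U consists of the cosets
  inside N, and W of the cosets inside H x K^q that are not contained in a single coset of N.\<close>

lemma not_simply_connected_coset_poset_DirProd:
  assumes "group H" "group K" "carrier H \<noteq> {\<one>\<^bsub>H\<^esub>}" "carrier K \<noteq> {\<one>\<^bsub>K\<^esub>}"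
    and "cyclic_prime_power_group H" "cyclic_prime_power_group K"
  shows "\<not> simply_connected_space (order_complex_realization (coset_poset (H \<times>\<times> K)) (\<subseteq>))"
proof -
  interpret H: group H by fact
  interpret K: group K by fact
  let ?G = "H \<times>\<times> K"
  let ?V = "coset_poset ?G"
  interpret G: group ?G by (rule DirProd_group) fact+
  interpret vertex_relation ?V "(\<subseteq>)" .
  obtain a p m L where a: "a \<in> carrier H" and p: "Factorial_Ring.prime (p::int)"
    and H: "carrier H = range (\<lambda>n::int. a [^]\<^bsub>H\<^esub> n)" and ap: "a [^]\<^bsub>H\<^esub> (p ^ m) = \<one>\<^bsub>H\<^esub>"
    and L: "\<And>x. x \<in> carrier H \<Longrightarrow> a [^]\<^bsub>H\<^esub> L x = x" "\<And>i. p dvd L (a [^]\<^bsub>H\<^esub> i) - i"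
    using H.cyclic_prime_power_group_log[OF assms(5,3)] by metis
  obtain b q n M where b: "b \<in> carrier K" and q: "Factorial_Ring.prime (q::int)"
    and K: "carrier K = range (\<lambda>n::int. b [^]\<^bsub>K\<^esub> n)" and bq: "b [^]\<^bsub>K\<^esub> (q ^ n) = \<one>\<^bsub>K\<^esub>"
    and M: "\<And>x. x \<in> carrier K \<Longrightarrow> b [^]\<^bsub>K\<^esub> M x = x" "\<And>i. q dvd M (b [^]\<^bsub>K\<^esub> i) - i"
    using K.cyclic_prime_power_group_log[OF assms(6,4)] by metis
  \<comment> \<open>The surjection from Z^2 onto H x K given by the two generators; the chosen
    logarithms form a section of it.\<close>
  define \<psi> where "\<psi> = (\<lambda>(i::int, j::int). (a [^]\<^bsub>H\<^esub> i, b [^]\<^bsub>K\<^esub> j))"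
  have \<psi>: "\<psi> x \<in> carrier ?G" for x using a b by (auto simp: \<psi>_def split: prod.split)
  have \<psi>_add: "\<psi> (i + i', j + j') = \<psi> (i, j) \<otimes>\<^bsub>?G\<^esub> \<psi> (i', j')" for i j i' j'
    using a b by (simp add: \<psi>_def H.int_pow_mult K.int_pow_mult)
  have \<psi>_minus: "\<psi> (- i, - j) = inv\<^bsub>?G\<^esub> \<psi> (i, j)" for i j
    using a b by (simp add: \<psi>_def H.int_pow_neg K.int_pow_neg H.is_group K.is_group)
  have \<psi>_pow: "\<psi> (s * i, s * j) = \<psi> (i, j) [^]\<^bsub>?G\<^esub> s" for s i j :: int
  proof (induction s rule: int_induct[where k = 0])
    case base
    show ?case by (simp add: \<psi>_def)
  next
    case (step1 s)
    have "\<psi> ((s + 1) * i, (s + 1) * j) = \<psi> (s * i, s * j) \<otimes>\<^bsub>?G\<^esub> \<psi> (i, j)"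
      by (simp add: \<psi>_add[symmetric] algebra_simps)
    then show ?case using step1 \<psi> by (simp add: G.int_pow_mult)
  next
    case (step2 s)
    have "\<psi> ((s - 1) * i, (s - 1) * j) = \<psi> (s * i, s * j) \<otimes>\<^bsub>?G\<^esub> \<psi> (- i, - j)"
      by (simp add: \<psi>_add[symmetric] algebra_simps)
    then show ?case using step2 \<psi> by (simp add: G.int_pow_diff \<psi>_minus)
  qed
  have \<psi>_log: "\<psi> (L (fst x), M (snd x)) = x" if "x \<in> carrier ?G" for x
    using that L(1) M(1) by (auto simp: \<psi>_def)
  define U where "U = {C \<in> ?V. \<forall>x\<in>C. p dvd L (fst x) \<and> q dvd M (snd x)}"
  define W where "W = {C \<in> ?V. (\<forall>x\<in>C. q dvd M (snd x)) \<and> (\<exists>x\<in>C. \<exists>y\<in>C. \<not> p dvd L (fst x) - L (fst y))}"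
  have VD: "C \<subseteq> carrier ?G" "C \<noteq> {}" "C \<noteq> carrier ?G" if "C \<in> ?V" for C
    using that G.coset_poset_iff_heap by auto
  \<comment> \<open>\<open>S\<close> is the preimage under \<open>\<psi>\<close> of the subgroup
    y^-1 C. The points \<open>x\<close> and \<open>z\<close> supply two independent vectors modulo
    (p, q), so \<open>lattice_eq_UNIV\<close> applies.\<close>
  have top: "C = carrier ?G"
    if C: "C \<in> ?V" and x: "x \<in> C" and y: "y \<in> C" and z: "z \<in> C"
      and xy: "\<not> p dvd L (fst x) - L (fst y)" "q dvd M (snd x)" "q dvd M (snd y)" and "\<not> q dvd M (snd z)"
    for C x y z
  proof -
    define S where "S = {ij. y \<otimes>\<^bsub>?G\<^esub> \<psi> ij \<in> C}"
    have yG: "y \<in> carrier ?G" using VD(1)[OF C] y by auto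
    have mult: "y \<otimes>\<^bsub>?G\<^esub> g [^]\<^bsub>?G\<^esub> (s::int) \<in> C" if "y \<otimes>\<^bsub>?G\<^esub> g \<in> C" "g \<in> carrier ?G" for g s
      using G.coset_poset_int_pow[OF C y that(1), of s] that yG by simp
    have lin: "(s * i + t * i', s * j + t * j') \<in> S" if ij: "(i, j) \<in> S" "(i', j') \<in> S" for s t i j i' j'
    proof -
      have "y \<otimes>\<^bsub>?G\<^esub> \<psi> (s * i, s * j) \<in> C" "y \<otimes>\<^bsub>?G\<^esub> \<psi> (t * i', t * j') \<in> C"
        unfolding \<psi>_pow using ij by (auto simp: S_def intro!: mult \<psi>)
      then have "(y \<otimes>\<^bsub>?G\<^esub> \<psi> (s * i, s * j)) \<otimes>\<^bsub>?G\<^esub> inv\<^bsub>?G\<^esub> y \<otimes>\<^bsub>?G\<^esub> (y \<otimes>\<^bsub>?G\<^esub> \<psi> (t * i', t * j')) \<in> C"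
        using G.coset_poset_heap[OF C] y by blast
      moreover have "(y \<otimes>\<^bsub>?G\<^esub> \<psi> (s * i, s * j)) \<otimes>\<^bsub>?G\<^esub> inv\<^bsub>?G\<^esub> y \<otimes>\<^bsub>?G\<^esub> (y \<otimes>\<^bsub>?G\<^esub> \<psi> (t * i', t * j'))
          = y \<otimes>\<^bsub>?G\<^esub> \<psi> (s * i + t * i', s * j + t * j')"
        unfolding \<psi>_add using yG \<psi> by (simp only: G.m_assoc G.m_closed G.inv_closed G.inv_mult_cancel)
      ultimately show ?thesis by (simp add: S_def)
    qed
    have \<psi>_diff: "y \<otimes>\<^bsub>?G\<^esub> \<psi> (L (fst w) - L (fst y), M (snd w) - M (snd y)) = w" if "w \<in> carrier ?G" for w
    proof -
      have "\<psi> (- L (fst y) + L (fst w), - M (snd y) + M (snd w)) = inv\<^bsub>?G\<^esub> y \<otimes>\<^bsub>?G\<^esub> w"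
        unfolding \<psi>_add \<psi>_minus using \<psi>_log that yG by simp
      then show ?thesis using that yG by (simp add: G.inv_mult_cancel del: mult_DirProd inv_DirProd)
    qed
    have diff: "(L (fst w) - L (fst y), M (snd w) - M (snd y)) \<in> S" if "w \<in> C" for w
      using \<psi>_diff[of w] that VD(1)[OF C] by (auto simp: S_def)
    have "\<psi> (p ^ m, 0) = \<one>\<^bsub>?G\<^esub>" "\<psi> (0, q ^ n) = \<one>\<^bsub>?G\<^esub>" by (simp_all add: \<psi>_def ap bq)
    then have PQ: "(p ^ m, 0) \<in> S" "(0, q ^ n) \<in> S" using y yG by (simp_all add: S_def del: one_DirProd)
    have qd: "q dvd M (snd x) - M (snd y)" using xy by simp
    have nqd: "\<not> q dvd M (snd z) - M (snd y)"
      using xy(3) \<open>\<not> q dvd M (snd z)\<close> dvd_diff_left_iff by blast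
    have "S = UNIV"
      by (rule lattice_eq_UNIV[OF lin p q PQ diff[OF x] xy(1) qd diff[OF z] nqd])
    then have "y \<otimes>\<^bsub>?G\<^esub> \<psi> ij \<in> C" for ij unfolding S_def by blast
    then have "w \<in> C" if "w \<in> carrier ?G" for w
      using \<psi>_diff[OF that] by metis
    then show ?thesis using VD(1)[OF C] by blast
  qed
  have disj: "U \<inter> W = {}" unfolding U_def W_def using dvd_diff by blast
  have cut: "z \<in> U \<union> W" if chain: "poset_chain ?V (\<subseteq>) {x, y, z}" and x: "x \<in> U" and y: "y \<in> W" for x y z
  proof -
    have z: "z \<in> ?V" and cmp: "z \<subseteq> x \<or> x \<subseteq> z" "z \<subseteq> y \<or> y \<subseteq> z" using chain by (auto simp: poset_chain_def)
    obtain x0 where x0: "x0 \<in> x" "p dvd L (fst x0)" using x VD(2) by (fastforce simp: U_def)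
    obtain y1 y2 where y12: "y1 \<in> y" "y2 \<in> y" "\<not> p dvd L (fst y1) - L (fst y2)"
      "q dvd M (snd y1)" "q dvd M (snd y2)" using y by (auto simp: W_def)
    \<comment> \<open>Below \<open>x\<close> membership in \<open>U\<close> is inherited. Between
      \<open>x\<close> and \<open>y\<close>, either two first logarithms differ modulo p, giving
      \<open>W\<close>, or all agree with that of a point of \<open>x\<close>, giving
      \<open>U\<close>. Above \<open>y\<close>, leaving the row would make \<open>z\<close> the
      whole group by \<open>top\<close>, so \<open>z\<close> is in \<open>W\<close>.\<close>
    consider "z \<subseteq> x" | "x \<subseteq> z" "z \<subseteq> y" | "y \<subseteq> z" using cmp by blast
    then show ?thesis
    proof cases
      case 1
      then have "z \<in> U" using x z by (auto simp: U_def)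
      then show ?thesis ..
    next
      case 2
      have zM: "\<forall>w\<in>z. q dvd M (snd w)" using 2 y by (auto simp: W_def)
      show ?thesis
      proof (cases "\<exists>u\<in>z. \<exists>v\<in>z. \<not> p dvd L (fst u) - L (fst v)")
        case True
        then show ?thesis using z zM by (auto simp: W_def)
      next
        case False
        then have "p dvd L (fst u)" if "u \<in> z" for u
          using that x0 2(1) dvd_diff_left_iff by blast
        then show ?thesis using z zM by (auto simp: U_def)
      qed
    next
      case 3
      have "\<forall>w\<in>z. q dvd M (snd w)"
        using top[OF z, of y1 y2] y12 3 VD(3)[OF z] by blast
      then have "z \<in> W" unfolding W_def using z y12(1-3) 3 by blast
      then show ?thesis ..
    qed
  qed

  \<comment> \<open>The closed edge path around a rectangle\<close>
  have La: "\<not> p dvd L a"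
  proof
    assume "p dvd L a"
    moreover have "p dvd L a - 1" using L(2)[of 1] a by simp
    ultimately have "p dvd 1" using dvd_diff[of p "L a" "L a - 1"] by simp
    then show False using p by (metis not_prime_unit)
  qed
  have L1: "p dvd L \<one>\<^bsub>H\<^esub>" using L(2)[of 0] a by simp
  have Mb: "\<not> q dvd M b"
  proof
    assume "q dvd M b"
    moreover have "q dvd M b - 1" using M(2)[of 1] b by simp
    ultimately have "q dvd 1" using dvd_diff[of q "M b" "M b - 1"] by simp
    then show False using q by (metis not_prime_unit)
  qed
  have M1: "q dvd M \<one>\<^bsub>K\<^esub>" using M(2)[of 0] b by simp
  have "a \<noteq> \<one>\<^bsub>H\<^esub>" "b \<noteq> \<one>\<^bsub>K\<^esub>" using La L1 Mb M1 by auto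
  have pt: "{(h, k)} \<in> ?V" if "h \<in> carrier H" "k \<in> carrier K" for h k
  proof -
    obtain h' where "h' \<in> carrier H" "h' \<noteq> h" using a H.one_closed \<open>a \<noteq> \<one>\<^bsub>H\<^esub>\<close> by metis
    then show ?thesis using that
      by (intro G.coset_posetI[of _ "(h, k)" "(h', k)"]) (auto simp: H.m_assoc K.m_assoc)
  qed
  have col: "{h} \<times> carrier K \<in> ?V" if "h \<in> carrier H" for h
  proof -
    obtain h' where "h' \<in> carrier H" "h' \<noteq> h" using a H.one_closed \<open>a \<noteq> \<one>\<^bsub>H\<^esub>\<close> by metis
    then show ?thesis using that b
      by (intro G.coset_posetI[of _ "(h, b)" "(h', b)"]) (auto simp: H.m_assoc)
  qed
  have row: "carrier H \<times> {k} \<in> ?V" if "k \<in> carrier K" for k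
  proof -
    obtain k' where "k' \<in> carrier K" "k' \<noteq> k" using b K.one_closed \<open>b \<noteq> \<one>\<^bsub>K\<^esub>\<close> by metis
    then show ?thesis using that a
      by (intro G.coset_posetI[of _ "(a, k)" "(a, k')"]) (auto simp: K.m_assoc)
  qed
  let ?e = "\<one>\<^bsub>H\<^esub>" and ?f = "\<one>\<^bsub>K\<^esub>"
  \<comment> \<open>The list runs around the rectangle on (1,1), (a,1), (a,b), (1,b); the edge from
    {(1,1)} to H x 1 is left out as the closing edge.\<close>
  let ?l = "[carrier H \<times> {?f}, {(a, ?f)}, {a} \<times> carrier K, {(a, b)}, carrier H \<times> {b}, {(?e, b)},
    {?e} \<times> carrier K, {(?e, ?f)}]"
  note V = pt[OF a b] pt[OF a K.one_closed] pt[OF H.one_closed b] pt[OF H.one_closed K.one_closed]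
    col[OF a] col[OF H.one_closed] row[OF b] row[OF K.one_closed]
  have U: "{(?e, ?f)} \<in> U" using V L1 M1 by (simp add: U_def)
  have W: "carrier H \<times> {?f} \<in> W"
  proof -
    have "\<not> p dvd L a - L ?e" using La L1 dvd_diff_left_iff by blast
    then have "\<exists>x\<in>carrier H \<times> {?f}. \<exists>y\<in>carrier H \<times> {?f}. \<not> p dvd L (fst x) - L (fst y)"
      using a H.one_closed by (intro bexI[of _ "(a, ?f)"] bexI[of _ "(?e, ?f)"]) auto
    then show ?thesis using V M1 by (auto simp: W_def)
  qed
  have notU: "C \<notin> U" if "(h, k) \<in> C" "\<not> p dvd L h \<or> \<not> q dvd M k" for C h k
    using that by (force simp: U_def)
  have notU': "{(a, ?f)} \<notin> U" "{a} \<times> carrier K \<notin> U" "{(a, b)} \<notin> U" "carrier H \<times> {b} \<notin> U"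
    "{(?e, b)} \<notin> U" "{?e} \<times> carrier K \<notin> U" "carrier H \<times> {?f} \<notin> U"
    by (rule notU[of a ?f] notU[of a b] notU[of ?e b]; use La Mb a b in simp; fail)+
  \<comment> \<open>Its first component is constant, so no two logarithms there differ. This keeps
    the last edge of the list, the only one that meets \<open>U\<close>, from crossing.\<close>
  have notW: "{?e} \<times> carrier K \<notin> W" by (auto simp: W_def)
  show ?thesis
  proof (rule not_simply_connected_realization[where U = U and W = W and l = ?l])
    show "U \<inter> W = {}" by (rule disj)
    show "z \<in> U \<union> W" if "poset_chain ?V (\<subseteq>) {x, y, z}" "x \<in> U" "y \<in> W" for x y z
      using that by (rule cut)
    show "edge_path ?l" "poset_chain ?V (\<subseteq>) {last ?l, hd ?l}"
      using V a b by (auto simp: poset_chain_def)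
    show "hd ?l \<in> W" "last ?l \<in> U" using U W by simp_all
    show "successively (\<lambda>u v. \<not> (u \<in> U \<and> v \<in> W) \<and> \<not> (u \<in> W \<and> v \<in> U)) ?l"
      using notU' notW by simp
  qed
qed

theorem mainTheorem7:
  fixes H :: "('a, 'c) monoid_scheme" and K :: "('b, 'd) monoid_scheme"
  assumes "group H" and "group K"
    and "carrier H \<noteq> {\<one>\<^bsub>H\<^esub>}" and "carrier K \<noteq> {\<one>\<^bsub>K\<^esub>}"
  shows "\<not> simply_connected_space
            (order_complex_realization (coset_poset (H \<times>\<times> K)) (\<subseteq>))
         \<longleftrightarrow> cyclic_prime_power_group H \<and> cyclic_prime_power_group K"
  using simply_connected_coset_poset_DirProd_left[OF assms]
    simply_connected_coset_poset_DirProd_right[OF assms]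
    not_simply_connected_coset_poset_DirProd[OF assms] by blast

end
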